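(* Let $L:\mathbb{T}^d\times\mathbb{R}^d\to\mathbb{R}$ be continuous with $\lim_{|v|\to\infty}\inf_{x\in\mathbb{T}^d}L(x,v)/|v|=+\infty$. Then a Mather measure $\mu$ exists. Moreover, if $(\varphi,\overline{H})$ is a viscosity solution to $H(x,-\nabla\varphi)=\overline{H}$ (so $\overline{H}$ is the Mañé critical value), then \[\int_{\mathbb{T}^d\times\mathbb{R}^d}L(x,v)\,\mu(d(x,v))=-\overline{H}.\]
   Context: $\mathbb{T}^d=\mathbb{R}^d/\mathbb{Z}^d$. $H(x,p)=\max_{v\in\mathbb{R}^d}[pv-L(x,v)]$. Hadamard sub/superdifferentials: $p\in\partial_D^\mp\varphi(x)$ iff for all $w$, $\liminf_{h\downarrow0,w'\to w}\frac{\varphi(x+hw')-\varphi(x)}{h}\ge pw$ (resp. $\limsup\ldots\le pw$). $(\varphi,\overline{H})$, $\varphi$ continuous, $\overline{H}\in\mathbb{R}$, is a viscosity solution if $H(x,-p)\le\overline{H}$ for $p\in\partial_D^+\varphi(x)$ and $H(x,-p)\ge\overline{H}$ for $p\in\partial_D^-\varphi(x)$, for all $x$. A probability measure $\nu$ on $\mathbb{T}^d\times\mathbb{R}^d$ is holonomic if $\int\nabla\phi(x)v\,\nu(d(x,v))=0$ for every $\phi\in C^1(\mathbb{T}^d)$ ($\nabla\phi(x)$ a row vector). A Mather measure is a holonomic probability measure $\mu$ with $\int L\,d\mu=\inf\{\int L\,d\nu:\nu\text{ holonomic}\}$. *)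

theory Defs
  imports "HOL-Analysis.Analysis" "HOL-Probability.Probability"
begin

text \<open>The torus T^d = R^d / Z^d is represented by Z^d-periodic functions on R^d
  (dimension d = CARD('n)); measures on T^d x R^d are Borel probability measures on
  R^d x R^d concentrated on the fundamental domain [0,1)^d x R^d.\<close>

definition zperiodic :: "(real^'n \<Rightarrow> 'b) \<Rightarrow> bool" where
  "zperiodic f \<longleftrightarrow> (\<forall>x k. (\<forall>i. k $ i \<in> \<int>) \<longrightarrow> f (x + k) = f x)"

definition fund_dom :: "(real^'n) set" where
  "fund_dom = {x. \<forall>i. 0 \<le> x $ i \<and> x $ i < 1}"

definition hamiltonian :: "(real^'n \<Rightarrow> real^'n \<Rightarrow> real) \<Rightarrow> real^'n \<Rightarrow> real^'n \<Rightarrow> real" where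
  "hamiltonian L x p = (SUP v. p \<bullet> v - L x v)"

definition hsubdiff :: "(real^'n \<Rightarrow> real) \<Rightarrow> real^'n \<Rightarrow> (real^'n) set" where
  "hsubdiff \<phi> x = {p. \<forall>w. Liminf (at_right 0 \<times>\<^sub>F nhds w)
       (\<lambda>(h, w'). ereal ((\<phi> (x + h *\<^sub>R w') - \<phi> x) / h)) \<ge> ereal (p \<bullet> w)}"

definition hsupdiff :: "(real^'n \<Rightarrow> real) \<Rightarrow> real^'n \<Rightarrow> (real^'n) set" where
  "hsupdiff \<phi> x = {p. \<forall>w. Limsup (at_right 0 \<times>\<^sub>F nhds w)
       (\<lambda>(h, w'). ereal ((\<phi> (x + h *\<^sub>R w') - \<phi> x) / h)) \<le> ereal (p \<bullet> w)}"

definition viscosity_solution ::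
  "(real^'n \<Rightarrow> real^'n \<Rightarrow> real) \<Rightarrow> (real^'n \<Rightarrow> real) \<Rightarrow> real \<Rightarrow> bool" where
  "viscosity_solution L \<phi> Hbar \<longleftrightarrow>
     continuous_on UNIV \<phi> \<and> zperiodic \<phi> \<and>
     (\<forall>x. \<forall>p \<in> hsupdiff \<phi> x. hamiltonian L x (- p) \<le> Hbar) \<and>
     (\<forall>x. \<forall>p \<in> hsubdiff \<phi> x. hamiltonian L x (- p) \<ge> Hbar)"

definition torus_prob :: "((real^'n) \<times> (real^'n)) measure \<Rightarrow> bool" where
  "torus_prob \<nu> \<longleftrightarrow> sets \<nu> = sets borel \<and> prob_space \<nu> \<and> (AE z in \<nu>. fst z \<in> fund_dom)"

text \<open>Holonomic: for every C^1 periodic test function phi (with derivative D x),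
  the integral of D x v vanishes; we also require integrability of |v|, so that
  these integrals are defined.\<close>
definition holonomic :: "((real^'n) \<times> (real^'n)) measure \<Rightarrow> bool" where
  "holonomic \<nu> \<longleftrightarrow> torus_prob \<nu> \<and> integrable \<nu> (\<lambda>z. norm (snd z)) \<and>
     (\<forall>(\<phi> :: real^'n \<Rightarrow> real) D. zperiodic \<phi> \<and> (\<forall>x. (\<phi> has_derivative D x) (at x)) \<and>
        (\<forall>v. continuous_on UNIV (\<lambda>x. D x v)) \<longrightarrow>
        (\<integral>z. D (fst z) (snd z) \<partial>\<nu>) = 0)"

text \<open>Action int L d nu as an extended real (L is bounded below, so a non-integrable
  L has integral +infinity).\<close>
definition action :: "(real^'n \<Rightarrow> real^'n \<Rightarrow> real) \<Rightarrow> ((real^'n) \<times> (real^'n)) measure \<Rightarrow> ereal" where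
  "action L \<nu> = (if integrable \<nu> (\<lambda>z. L (fst z) (snd z))
                  then ereal (\<integral>z. L (fst z) (snd z) \<partial>\<nu>) else \<infinity>)"

definition mather_measure :: "(real^'n \<Rightarrow> real^'n \<Rightarrow> real) \<Rightarrow> ((real^'n) \<times> (real^'n)) measure \<Rightarrow> bool" where
  "mather_measure L \<mu> \<longleftrightarrow> holonomic \<mu> \<and>
     action L \<mu> = (INF \<nu> \<in> {\<nu>. holonomic \<nu>}. action L \<nu>)"

end

theory Submission
  imports Defs
begin

text \<open>
  Minimise, over probability measures with a fixed bound on the speed, the action plus a quadratic
  penalty on finitely many holonomy constraints. The first-order condition at the minimiser, tested
  against point masses, says that a finite combination of the test functions is an approximate
  \<open>C\<^sup>1\<close> subsolution \<open>L(x,v) + \<nabla>\<psi>(x)v \<ge> \<integral>L d\<mu>\<^sub>N\<close>. Letting the penalty tend to infinity produces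
  a holonomic measure \<open>\<mu>\<close> together with, for every \<open>\<epsilon> > 0\<close>, a \<open>C\<^sup>1\<close> function \<open>\<psi>\<close> with
  \<open>L + \<nabla>\<psi> v \<ge> \<integral>L d\<mu> - \<epsilon>\<close>; the function bounds the action of every holonomic measure from below, so
  \<open>\<mu>\<close> is minimal, and superlinearity makes the bound on the speed irrelevant.
  At a minimum point of \<open>\<phi> - \<psi>\<close> the supersolution property gives \<open>\<integral>L d\<mu> \<le> - H\<close>. Conversely, the
  subsolution property passes to segments by a penalised maximum, hence to mollifications of \<open>\<phi>\<close>, and
  these are admissible \<open>\<psi>\<close> with \<open>L + \<nabla>\<psi> v \<ge> - H - \<epsilon>\<close>.

  Weak compactness of measures on a cube is reduced to Helly's theorem on the line: all measures are
  taken on \<open>[0,1]\<close> and pushed forward by a space-filling curve.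
\<close>

subsection \<open>Penalised duality on the unit interval\<close>

text \<open>Distributions on the whole line that happen to live on [0,1], so that Helly's theorem
  and weak convergence of real distributions apply directly.\<close>

definition unit_dist :: "real measure \<Rightarrow> bool" where
  "unit_dist M \<longleftrightarrow> real_distribution M \<and> (AE t in M. t \<in> {0..1})"

lemma continuous_unit_bounded:
  fixes h :: "real \<Rightarrow> real"
  assumes "continuous_on UNIV h"
  obtains B where "\<And>t. 0 \<le> t \<Longrightarrow> t \<le> 1 \<Longrightarrow> \<bar>h t\<bar> \<le> B"
proof -
  have "compact (h ` {0..1})"
    by (intro compact_continuous_image continuous_on_subset[OF assms]) auto
  then have "\<exists>B. \<forall>t\<in>{0..1}. \<bar>h t\<bar> \<le> B"
    using compact_imp_bounded bounded_iff by (metis image_eqI real_norm_def)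
  then show ?thesis using that by (metis atLeastAtMost_iff)
qed

text \<open>Weak convergence only tests bounded continuous functions. Composing with the clamp onto
  [0,1] makes any continuous \<open>h\<close> bounded without changing its integral.\<close>

lemma unit_dist_integral_clamp:
  fixes h :: "real \<Rightarrow> real"
  assumes "unit_dist M" "continuous_on UNIV h"
  shows "integrable M h" "(\<integral>t. h t \<partial>M) = (\<integral>t. h (max 0 (min 1 t)) \<partial>M)"
proof -
  interpret real_distribution M using assms(1) by (simp add: unit_dist_def)
  have AE: "AE t in M. t \<in> {0..1}" using assms(1) by (simp add: unit_dist_def)
  have hm[measurable]: "h \<in> borel_measurable borel"
    using assms(2) by (rule borel_measurable_continuous_onI)
  obtain B where B: "\<And>t. 0 \<le> t \<Longrightarrow> t \<le> 1 \<Longrightarrow> \<bar>h t\<bar> \<le> B"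
    using continuous_unit_bounded[OF assms(2)] by blast
  show "integrable M h"
    by (rule integrable_const_bound[of _ B]) (use AE B in auto)
  show "(\<integral>t. h t \<partial>M) = (\<integral>t. h (max 0 (min 1 t)) \<partial>M)"
    by (rule integral_cong_AE) (use AE in auto)
qed

lemma unit_dist_integral_ge:
  fixes h :: "real \<Rightarrow> real"
  assumes "unit_dist M" "continuous_on UNIV h" "\<And>t. t \<in> {0..1} \<Longrightarrow> c \<le> h t"
  shows "c \<le> (\<integral>t. h t \<partial>M)"
proof -
  interpret real_distribution M using assms(1) by (simp add: unit_dist_def)
  have AE: "AE t in M. t \<in> {0..1}" using assms(1) by (simp add: unit_dist_def)
  show ?thesis
    by (rule integral_ge_const) (use unit_dist_integral_clamp[OF assms(1,2)] AE assms(3) in auto)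
qed

lemma unit_dist_integral_abs_le:
  fixes h :: "real \<Rightarrow> real"
  assumes "unit_dist M" "continuous_on UNIV h" "\<And>t. t \<in> {0..1} \<Longrightarrow> \<bar>h t\<bar> \<le> c"
  shows "\<bar>\<integral>t. h t \<partial>M\<bar> \<le> c"
proof -
  have "- c \<le> (\<integral>t. h t \<partial>M)"
    by (rule unit_dist_integral_ge[OF assms(1,2)]) (use assms(3) abs_le_iff in fastforce)
  moreover have "- c \<le> (\<integral>t. - h t \<partial>M)"
    by (rule unit_dist_integral_ge[OF assms(1)])
       (use assms(2,3) in \<open>auto intro!: continuous_intros simp: abs_le_iff\<close>)
  ultimately show ?thesis by simp
qed

text \<open>All mass sits in one compact interval, so tightness is free and a subsequence converges
  weakly. It remains to see that the limit still lives on [0,1] and, by clamping, that unbounded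
  \<open>h\<close> are allowed.\<close>

lemma unit_dist_seq_compact:
  assumes "\<And>n. unit_dist (M n)"
  obtains r :: "nat \<Rightarrow> nat" and N where "strict_mono r" "unit_dist N"
    "\<And>h::real \<Rightarrow> real. continuous_on UNIV h \<Longrightarrow> (\<lambda>n. \<integral>t. h t \<partial>M (r n)) \<longlonglongrightarrow> (\<integral>t. h t \<partial>N)"
proof -
  have rd: "real_distribution (M n)" for n using assms by (simp add: unit_dist_def)
  \<comment> \<open>Left end -1 and not 0: the half-open interval must contain a possible atom at
    0.\<close>
  have full: "measure (M n) {-1<..1} = 1" for n
  proof -
    interpret real_distribution "M n" by (rule rd)
    show ?thesis
      by (subst prob_eq_1) (use assms[of n] in \<open>auto simp: unit_dist_def elim!: eventually_mono\<close>)
  qed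
  have "tight M"
    unfolding tight_def
  proof (intro conjI allI impI)
    fix \<epsilon> :: real assume "\<epsilon> > 0"
    then show "\<exists>a b. a < b \<and> (\<forall>n. measure (M n) {a<..b} > 1 - \<epsilon>)"
      using full by (intro exI[of _ "-1"] exI[of _ 1]) auto
  qed (rule rd)
  then obtain r N where r: "strict_mono (r :: nat \<Rightarrow> nat)" and N: "real_distribution N"
    and wc: "weak_conv_m (M \<circ> id \<circ> r) N"
    using tight_imp_convergent_subsubsequence[of M id] by (auto simp: strict_mono_id)
  have conv: "(\<lambda>n. \<integral>t. h t \<partial>M (r n)) \<longlonglongrightarrow> (\<integral>t. h t \<partial>N)"
    if "continuous_on UNIV h" "\<And>x. norm (h x) \<le> B" for h :: "real \<Rightarrow> real" and B
    using weak_conv_imp_integral_bdd_continuous_conv[OF _ N wc, of h B] rd that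
    by (auto simp: continuous_on_eq_continuous_at)
  \<comment> \<open>\<open>d\<close> is bounded, continuous and zero exactly on [0,1]; its vanishing
    integrals pass to the limit and confine \<open>N\<close> to the interval.\<close>
  define d where "d t = min 1 \<bar>t - max 0 (min 1 t)\<bar>" for t :: real
  have dc: "continuous_on UNIV d" unfolding d_def by (intro continuous_intros)
  have "(\<integral>t. d t \<partial>M n) = 0" for n
    using unit_dist_integral_clamp(2)[OF assms dc, of n] by (simp add: d_def)
  then have d0: "(\<integral>t. d t \<partial>N) = 0"
    using conv[OF dc, of 1] LIMSEQ_unique[OF _ tendsto_const] by (force simp: d_def)
  interpret N: real_distribution N by (rule N)
  have "integrable N d"
    by (rule N.integrable_const_bound[of _ 1])
       (use borel_measurable_continuous_onI[OF dc] in \<open>auto simp: d_def\<close>)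
  then have "AE t in N. d t = 0"
    using d0 by (subst (asm) integral_nonneg_eq_0_iff_AE) (auto simp: d_def)
  then have "AE t in N. t \<in> {0..1}"
    by (rule eventually_mono) (auto simp: d_def min_def max_def split: if_splits)
  then have uN: "unit_dist N" using N by (simp add: unit_dist_def)
  have "(\<lambda>n. \<integral>t. h t \<partial>M (r n)) \<longlonglongrightarrow> (\<integral>t. h t \<partial>N)" if h: "continuous_on UNIV h" for h :: "real \<Rightarrow> real"
  proof -
    obtain B where B: "\<And>t. 0 \<le> t \<Longrightarrow> t \<le> 1 \<Longrightarrow> \<bar>h t\<bar> \<le> B"
      using continuous_unit_bounded[OF h] by blast
    have "(\<lambda>n. \<integral>t. h (max 0 (min 1 t)) \<partial>M (r n)) \<longlonglongrightarrow> (\<integral>t. h (max 0 (min 1 t)) \<partial>N)"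
      by (rule conv[of _ B]) (auto intro!: B continuous_on_compose2[OF h] continuous_intros)
    then show ?thesis using unit_dist_integral_clamp(2)[OF _ h] assms uN by simp
  qed
  with r uN show ?thesis by (rule that)
qed

lemma unit_dist_return: "t \<in> {0..1} \<Longrightarrow> unit_dist (return borel t)"
  unfolding unit_dist_def real_distribution_def real_distribution_axioms_def
  by (auto simp: AE_return intro!: prob_space_return)

text \<open>Realised as the law of a random choice: an independent Bernoulli coin with parameter
  \<open>s\<close> decides between \<open>z\<close> and a sample of \<open>M\<close>.\<close>

lemma unit_dist_mixture:
  fixes z s :: real
  assumes M: "unit_dist M" and z: "z \<in> {0..1}" and s: "s \<in> {0..1}"
  obtains M' where "unit_dist M'"
    "\<And>h::real \<Rightarrow> real. continuous_on UNIV h \<Longrightarrow> (\<integral>t. h t \<partial>M') = (1 - s) * (\<integral>t. h t \<partial>M) + s * h z"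
proof -
  interpret M: real_distribution M using M by (simp add: unit_dist_def)
  have AE: "AE t in M. t \<in> {0..1}" using M by (simp add: unit_dist_def)
  let ?B = "measure_pmf (bernoulli_pmf s)"
  interpret P: pair_prob_space M ?B ..
  define f where "f = (\<lambda>(t, b). if b then z else t)"
  have f[measurable]: "f \<in> borel_measurable (M \<Otimes>\<^sub>M ?B)"
    unfolding f_def by measurable
  define M' where "M' = distr (M \<Otimes>\<^sub>M ?B) borel f"
  have rd: "real_distribution M'"
    unfolding M'_def by (rule P.real_distribution_distr) simp
  \<comment> \<open>Stated for bounded measurable \<open>h\<close>, because the support of
    \<open>M'\<close> is tested on an indicator.\<close>
  have int: "(\<integral>t. h t \<partial>M') = (1 - s) * (\<integral>t. h t \<partial>M) + s * h z"
    if h: "h \<in> borel_measurable borel" and hB: "\<And>t. norm (h t) \<le> B" for h :: "real \<Rightarrow> real" and B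
  proof -
    have [measurable]: "h \<in> borel_measurable borel" by (rule h)
    have ih: "integrable M h" by (rule M.integrable_const_bound[of _ B]) (auto simp: hB[simplified])
    have i: "integrable (M \<Otimes>\<^sub>M ?B) (\<lambda>p. h (f p))"
      by (rule P.integrable_const_bound[of _ B]) (auto simp: hB[simplified])
    have "(\<integral>t. h t \<partial>M') = (\<integral>p. h (f p) \<partial>(M \<Otimes>\<^sub>M ?B))"
      unfolding M'_def by (subst integral_distr) auto
    also have "\<dots> = (\<integral>t. (\<integral>b. h (f (t, b)) \<partial>?B) \<partial>M)"
      by (rule P.integral_fst'[OF i, symmetric])
    also have "\<dots> = (\<integral>t. s * h z + (1 - s) * h t \<partial>M)"
      using s by (simp add: f_def mult.commute)
    also have "\<dots> = (1 - s) * (\<integral>t. h t \<partial>M) + s * h z"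
      using ih M.prob_space by simp
    finally show ?thesis .
  qed
  have "(\<integral>t. indicator (- {0..1}) t \<partial>M) = (0::real)"
    by (rule integral_eq_zero_AE) (use AE in \<open>auto simp: indicator_def elim!: eventually_mono\<close>)
  then have "(\<integral>t. indicator (- {0..1::real}) t \<partial>M') = (0::real)"
    using int[of "indicator (- {0..1})" 1] z by (simp add: indicator_def)
  moreover interpret M': real_distribution M' by (rule rd)
  have "M'.prob (- {0..1}) = 0" using calculation by simp
  then have "AE t in M'. t \<notin> - {0..1}"
    by (subst (asm) M'.prob_eq_0) auto
  then have u: "unit_dist M'" using rd by (simp add: unit_dist_def)
  show ?thesis
  proof (rule that[OF u])
    fix h :: "real \<Rightarrow> real" assume h: "continuous_on UNIV h"
    obtain B where B: "\<And>t. 0 \<le> t \<Longrightarrow> t \<le> 1 \<Longrightarrow> \<bar>h t\<bar> \<le> B"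
      using continuous_unit_bounded[OF h] by blast
    let ?h = "\<lambda>t. h (max 0 (min 1 t))"
    have "continuous_on UNIV ?h" by (auto intro!: continuous_on_compose2[OF h] continuous_intros)
    then have "(\<integral>t. ?h t \<partial>M') = (1 - s) * (\<integral>t. ?h t \<partial>M) + s * ?h z"
      by (intro int[of _ B] borel_measurable_continuous_onI) (auto intro!: B)
    then show "(\<integral>t. h t \<partial>M') = (1 - s) * (\<integral>t. h t \<partial>M) + s * h z"
      using unit_dist_integral_clamp(2)[OF _ h] u M z by simp
  qed
qed

text \<open>Bernstein polynomials with rational coefficients are countable and uniformly dense, but
  need not belong to \<open>V\<close>. For each of them and each tolerance, one nearby member of
  \<open>V\<close> is chosen if there is any.\<close>

lemma continuous_unit_countable_dense:
  fixes V :: "(real \<Rightarrow> real) set"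
  assumes V: "\<And>f. f \<in> V \<Longrightarrow> continuous_on UNIV f" and "V \<noteq> {}"
  obtains F :: "nat \<Rightarrow> real \<Rightarrow> real" where "range F \<subseteq> V"
    "\<And>f e. f \<in> V \<Longrightarrow> e > 0 \<Longrightarrow> \<exists>k. \<forall>t\<in>{0..1}. \<bar>f t - F k t\<bar> < e"
proof -
  define Q :: "rat list \<Rightarrow> real \<Rightarrow> real" where
    "Q q t = (\<Sum>k\<le>length q - 1. of_rat (q ! k) * Bernstein (length q - 1) k t)" for q t
  have Q: "\<exists>q. \<forall>t\<in>{0..1}. \<bar>f t - Q q t\<bar> < e" if f: "continuous_on UNIV f" and e: "e > 0" for f e
  proof -
    have "continuous_on {0..1} f" using f continuous_on_subset by blast
    then obtain n where n: "\<And>x. x \<in> {0..1} \<Longrightarrow> \<bar>f x - (\<Sum>k\<le>n. f(k/n) * Bernstein n k x)\<bar> < e/2"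
      using Bernstein_Weierstrass[of f "e/2"] e by (metis half_gt_zero order_refl)
    have "\<exists>q. \<bar>f (k/n) - of_rat q\<bar> < e/2" for k :: nat
    proof -
      obtain q where "f (k/n) - e/2 < of_rat q" "of_rat q < f (k/n) + e/2"
        using of_rat_dense[of "f (k/n) - e/2" "f (k/n) + e/2"] e by auto
      then show ?thesis by (intro exI[of _ q]) linarith
    qed
    then obtain c where c: "\<And>k. \<bar>f (real k/n) - of_rat (c k)\<bar> < e/2" by metis
    define q where "q = map c [0..<Suc n]"
    have l: "length q - 1 = n" by (simp add: q_def)
    have qk: "q ! k = c k" if "k \<le> n" for k using that by (auto simp: q_def simp del: upt_Suc)
    have "\<bar>f t - Q q t\<bar> < e" if t: "t \<in> {0..1}" for t
    proof -
      have "\<bar>(\<Sum>k\<le>n. f(k/n) * Bernstein n k t) - Q q t\<bar>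
          = \<bar>\<Sum>k\<le>n. (f(k/n) - of_rat (c k)) * Bernstein n k t\<bar>"
        unfolding Q_def l by (simp add: qk sum_subtractf[symmetric] algebra_simps)
      also have "\<dots> \<le> (\<Sum>k\<le>n. e/2 * Bernstein n k t)"
        using t
        by (intro order_trans[OF sum_abs] sum_mono)
           (auto simp only: abs_mult abs_of_nonneg[OF Bernstein_nonneg] atLeastAtMost_iff
             intro!: mult_right_mono less_imp_le[OF c] Bernstein_nonneg)
      also have "\<dots> = e/2" by (simp only: sum_distrib_left[symmetric] sum_Bernstein mult_1_right)
      finally show ?thesis using n[OF t] by linarith
    qed
    then show ?thesis by blast
  qed
  obtain f0 where f0: "f0 \<in> V" using \<open>V \<noteq> {}\<close> by blast
  \<comment> \<open>The default \<open>f0\<close> keeps \<open>G\<close> inside \<open>V\<close>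
    when no member is close to the polynomial.\<close>
  define G where "G = (\<lambda>(q, n::nat). if \<exists>f\<in>V. \<forall>t\<in>{0..1}. \<bar>f t - Q q t\<bar> < 1 / Suc n
      then SOME f. f \<in> V \<and> (\<forall>t\<in>{0..1}. \<bar>f t - Q q t\<bar> < 1 / Suc n) else f0)"
  have G: "G (q, n) \<in> V" "f \<in> V \<Longrightarrow> \<forall>t\<in>{0..1}. \<bar>f t - Q q t\<bar> < 1 / Suc n \<Longrightarrow>
      \<forall>t\<in>{0..1}. \<bar>G (q, n) t - Q q t\<bar> < 1 / Suc n" for q n f
    using someI_ex[of "\<lambda>f. f \<in> V \<and> (\<forall>t\<in>{0..1}. \<bar>f t - Q q t\<bar> < 1 / Suc n)"] f0
    by (auto simp: G_def)
  show ?thesis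
  proof (rule that[of "\<lambda>k. G (from_nat k)"])
    show "range (\<lambda>k. G (from_nat k)) \<subseteq> V"
    proof safe
      fix k show "G (from_nat k) \<in> V" by (cases "from_nat k :: rat list \<times> nat") (simp add: G)
    qed
    fix f and e :: real assume f: "f \<in> V" and "e > 0"
    then obtain n where n: "1 / Suc n < e/2" using nat_approx_posE[of "e/2"] by auto
    obtain q where q: "\<forall>t\<in>{0..1}. \<bar>f t - Q q t\<bar> < 1 / Suc n" using Q[OF V[OF f], of "1 / Suc n"] by auto
    have "\<bar>f t - G (q, n) t\<bar> < e" if "t \<in> {0..1}" for t
      using bspec[OF q that] bspec[OF G(2)[OF f q] that] n by linarith
    then show "\<exists>k. \<forall>t\<in>{0..1}. \<bar>f t - G (from_nat k) t\<bar> < e"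
      by (intro exI[of _ "to_nat (q, n)"]) simp
  qed
qed

text \<open>The direct method: a minimising sequence has a weak limit, and the functional is weakly
  continuous since it involves only finitely many integrals of continuous functions.\<close>

lemma penalised_minimiser:
  fixes l :: "real \<Rightarrow> real" and F :: "nat \<Rightarrow> real \<Rightarrow> real"
  assumes l: "continuous_on UNIV l" and F: "\<And>k. continuous_on UNIV (F k)" and "N \<ge> 0"
  obtains M where "unit_dist M"
    "\<And>M'. unit_dist M' \<Longrightarrow> (\<integral>t. l t \<partial>M) + N * (\<Sum>k<n. (\<integral>t. F k t \<partial>M)\<^sup>2)
       \<le> (\<integral>t. l t \<partial>M') + N * (\<Sum>k<n. (\<integral>t. F k t \<partial>M')\<^sup>2)"
proof -
  define J where "J M = (\<integral>t. l t \<partial>M) + N * (\<Sum>k<n. (\<integral>t. F k t \<partial>M)\<^sup>2)" for M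
  obtain B where B: "\<And>t. 0 \<le> t \<Longrightarrow> t \<le> 1 \<Longrightarrow> \<bar>l t\<bar> \<le> B"
    using continuous_unit_bounded[OF l] by blast
  have lb: "- B \<le> J M" if "unit_dist M" for M
  proof -
    have "- B \<le> (\<integral>t. l t \<partial>M)"
      by (rule unit_dist_integral_ge[OF that l]) (use B in \<open>fastforce simp: abs_le_iff\<close>)
    moreover have "0 \<le> N * (\<Sum>k<n. (\<integral>t. F k t \<partial>M)\<^sup>2)"
      using \<open>N \<ge> 0\<close> by (intro mult_nonneg_nonneg sum_nonneg) auto
    ultimately show ?thesis by (simp add: J_def)
  qed
  let ?S = "J ` Collect unit_dist"
  have bdd: "bdd_below ?S" using lb by (intro bdd_belowI[of _ "-B"]) auto
  have ne: "?S \<noteq> {}" using unit_dist_return[of 0] by auto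
  have "\<exists>M. unit_dist M \<and> J M < Inf ?S + 1 / Suc j" for j
    using cInf_less_iff[OF ne bdd, of "Inf ?S + 1 / Suc j"] by auto
  then obtain M where M: "\<And>j. unit_dist (M j)" "\<And>j. J (M j) < Inf ?S + 1 / Suc j" by metis
  obtain r N' where r: "strict_mono r" "unit_dist N'"
    and conv: "\<And>h::real \<Rightarrow> real. continuous_on UNIV h \<Longrightarrow> (\<lambda>n. \<integral>t. h t \<partial>M (r n)) \<longlonglongrightarrow> (\<integral>t. h t \<partial>N')"
    using unit_dist_seq_compact[of M] M(1) by blast
  have "(\<lambda>j. J (M (r j))) \<longlonglongrightarrow> J N'"
    unfolding J_def by (intro tendsto_intros conv l F)
  moreover have "(\<lambda>j. Inf ?S + 1 / Suc (r j)) \<longlonglongrightarrow> Inf ?S + 0"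
    by (intro tendsto_intros LIMSEQ_subseq_LIMSEQ[OF LIMSEQ_Suc[OF lim_1_over_n] r(1), unfolded o_def])
  ultimately have "J N' \<le> Inf ?S + 0"
    by (rule LIMSEQ_le) (use M(2) less_imp_le in blast)
  then have "J N' \<le> J M'" if "unit_dist M'" for M'
    using cInf_lower[OF _ bdd, of "J M'"] that by auto
  then show ?thesis using that r(2) by (simp add: J_def)
qed

text \<open>Moving \<open>M\<close> towards the point mass at \<open>z\<close> is an admissible
  variation, so the one-sided derivative of the penalised functional in that direction is
  nonnegative.\<close>

lemma penalised_first_order:
  fixes l :: "real \<Rightarrow> real" and F :: "nat \<Rightarrow> real \<Rightarrow> real"
  assumes l: "continuous_on UNIV l" and F: "\<And>k. continuous_on UNIV (F k)" and N: "N \<ge> 0"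
    and M: "unit_dist M"
    and min: "\<And>M'. unit_dist M' \<Longrightarrow> (\<integral>t. l t \<partial>M) + N * (\<Sum>k<n. (\<integral>t. F k t \<partial>M)\<^sup>2)
       \<le> (\<integral>t. l t \<partial>M') + N * (\<Sum>k<n. (\<integral>t. F k t \<partial>M')\<^sup>2)"
    and z: "z \<in> {0..1}"
  shows "(\<integral>t. l t \<partial>M) \<le> l z + (\<Sum>k<n. 2 * N * (\<integral>t. F k t \<partial>M) * F k z)"
proof -
  define A where "A = (\<integral>t. l t \<partial>M)"
  define a where "a k = (\<integral>t. F k t \<partial>M)" for k
  \<comment> \<open>A mixing weight \<open>s\<close> changes the functional by exactly
    \<open>s * (X + s * Q)\<close>: \<open>X\<close> is the derivative at 0, \<open>Q\<close> the
    quadratic remainder.\<close>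
  define Q where "Q = N * (\<Sum>k<n. (F k z - a k)\<^sup>2)"
  define X where "X = l z - A + 2 * N * (\<Sum>k<n. a k * (F k z - a k))"
  have X: "0 \<le> X + s * Q" if s: "0 < s" "s \<le> 1" for s
  proof -
    obtain M' where M': "unit_dist M'"
      "\<And>h::real \<Rightarrow> real. continuous_on UNIV h \<Longrightarrow> (\<integral>t. h t \<partial>M') = (1 - s) * (\<integral>t. h t \<partial>M) + s * h z"
      using unit_dist_mixture[OF M z, of s] s by auto
    have "A + N * (\<Sum>k<n. (a k)\<^sup>2) \<le> (1 - s) * A + s * l z + N * (\<Sum>k<n. ((1 - s) * a k + s * F k z)\<^sup>2)"
      using min[OF M'(1)] M'(2)[OF l] M'(2)[OF F] by (simp add: A_def a_def)
    also have "(\<Sum>k<n. ((1 - s) * a k + s * F k z)\<^sup>2)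
      = (\<Sum>k<n. (a k)\<^sup>2) + 2 * s * (\<Sum>k<n. a k * (F k z - a k)) + s * s * (\<Sum>k<n. (F k z - a k)\<^sup>2)"
      unfolding sum_distrib_left sum.distrib[symmetric]
      by (intro sum.cong) (auto simp: power2_eq_square algebra_simps)
    finally have "0 \<le> s * (X + s * Q)" by (simp add: X_def Q_def algebra_simps)
    then show ?thesis using s by (simp add: zero_le_mult_iff)
  qed
  have "((\<lambda>s. X + s * Q) \<longlongrightarrow> X + 0 * Q) (at_right 0)" by (intro tendsto_intros)
  moreover have "eventually (\<lambda>s. 0 \<le> X + s * Q) (at_right 0)"
    using X by (auto simp: eventually_at_right_field intro!: exI[of _ 1])
  ultimately have "0 \<le> X + 0 * Q" by (intro tendsto_lowerbound) auto
  moreover have "0 \<le> 2 * N * (\<Sum>k<n. a k * a k)" using N by (simp add: sum_nonneg)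
  ultimately have "A \<le> l z + 2 * N * (\<Sum>k<n. a k * F k z)"
    by (simp add: X_def sum_subtractf right_diff_distrib)
  then show ?thesis by (simp add: A_def a_def sum_distrib_left mult.assoc)
qed

text \<open>Constrained minimisation with approximate Lagrange multipliers: limits of penalised
  minimisers satisfy the constraints, and the first-order condition at stage \<open>n\<close>
  supplies the multipliers \<open>2 * n * \<integral>F k\<close>. The common zero \<open>t0\<close>
  provides a feasible measure.\<close>

theorem unit_duality:
  fixes l :: "real \<Rightarrow> real" and V :: "(real \<Rightarrow> real) set"
  assumes l: "continuous_on UNIV l"
    and Vc: "\<And>f. f \<in> V \<Longrightarrow> continuous_on UNIV f"
    and V0: "(\<lambda>_. 0) \<in> V" and Va: "\<And>f g. f \<in> V \<Longrightarrow> g \<in> V \<Longrightarrow> (\<lambda>t. f t + g t) \<in> V"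
    and Vs: "\<And>f c. f \<in> V \<Longrightarrow> (\<lambda>t. c * f t) \<in> V"
    and t0: "t0 \<in> {0..1}" "\<And>f. f \<in> V \<Longrightarrow> f t0 = 0"
  obtains M where "unit_dist M" "\<And>f. f \<in> V \<Longrightarrow> (\<integral>t. f t \<partial>M) = 0"
    "\<And>e. e > 0 \<Longrightarrow> \<exists>f\<in>V. \<forall>t\<in>{0..1}. (\<integral>t. l t \<partial>M) - e \<le> l t + f t"
proof -
  obtain F :: "nat \<Rightarrow> real \<Rightarrow> real" where FV: "range F \<subseteq> V"
    and Fd: "\<And>f e. f \<in> V \<Longrightarrow> e > 0 \<Longrightarrow> \<exists>k. \<forall>t\<in>{0..1}. \<bar>f t - F k t\<bar> < e"
    using continuous_unit_countable_dense[OF Vc] V0 by blast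
  have Fc: "continuous_on UNIV (F k)" and F0: "F k t0 = 0" for k using FV Vc t0(2) by auto
  have sumV: "(\<lambda>t. \<Sum>k<n. c k * F k t) \<in> V" for c and n :: nat
  proof (induction n)
    case (Suc n)
    have "F n \<in> V" using FV by auto
    from Va[OF Suc Vs[OF this]] show ?case by simp
  qed (simp add: V0)
  have "\<exists>M. unit_dist M \<and> (\<forall>M'. unit_dist M' \<longrightarrow>
      (\<integral>t. l t \<partial>M) + real n * (\<Sum>k<n. (\<integral>t. F k t \<partial>M)\<^sup>2)
       \<le> (\<integral>t. l t \<partial>M') + real n * (\<Sum>k<n. (\<integral>t. F k t \<partial>M')\<^sup>2))" for n
    using penalised_minimiser[where F=F and l=l and N="real n" and n=n, OF l Fc] by (metis of_nat_0_le_iff)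
  then obtain M where M: "\<And>n. unit_dist (M n)"
    and min: "\<And>n M'. unit_dist M' \<Longrightarrow> (\<integral>t. l t \<partial>M n) + real n * (\<Sum>k<n. (\<integral>t. F k t \<partial>M n)\<^sup>2)
       \<le> (\<integral>t. l t \<partial>M') + real n * (\<Sum>k<n. (\<integral>t. F k t \<partial>M')\<^sup>2)" by metis
  have fo: "(\<integral>t. l t \<partial>M n) \<le> l z + (\<Sum>k<n. 2 * real n * (\<integral>t. F k t \<partial>M n) * F k z)"
    if "z \<in> {0..1}" for n z
    by (rule penalised_first_order[where F=F and l=l, OF l Fc _ M min that]) auto
  obtain B where B: "\<And>t. 0 \<le> t \<Longrightarrow> t \<le> 1 \<Longrightarrow> \<bar>l t\<bar> \<le> B"
    using continuous_unit_bounded[OF l] by blast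
  \<comment> \<open>Comparison with the point mass at \<open>t0\<close>, where the penalty vanishes:
    the total penalty is at most \<open>2 * B\<close> for every \<open>n\<close>.\<close>
  have small: "(\<integral>t. F k t \<partial>M n)\<^sup>2 \<le> 2 * B / n" if "k < n" for k n
  proof -
    have ret: "(\<integral>t. h t \<partial>return borel t0) = h t0" if "continuous_on UNIV h" for h :: "real \<Rightarrow> real"
      using that by (intro integral_return borel_measurable_continuous_onI) auto
    have "- B \<le> (\<integral>t. l t \<partial>M n)"
      by (rule unit_dist_integral_ge[OF M l]) (use B in \<open>fastforce simp: abs_le_iff\<close>)
    moreover have "(\<integral>t. l t \<partial>M n) + real n * (\<Sum>k<n. (\<integral>t. F k t \<partial>M n)\<^sup>2) \<le> l t0"
      using min[OF unit_dist_return[OF t0(1)], of n] ret[OF l] ret[OF Fc] F0 by simp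
    moreover have "l t0 \<le> B" using B[of t0] t0(1) by auto
    ultimately have "real n * (\<Sum>k<n. (\<integral>t. F k t \<partial>M n)\<^sup>2) \<le> 2 * B" by linarith
    moreover have "(\<integral>t. F k t \<partial>M n)\<^sup>2 \<le> (\<Sum>k<n. (\<integral>t. F k t \<partial>M n)\<^sup>2)"
      using that by (intro member_le_sum) auto
    ultimately have "real n * (\<integral>t. F k t \<partial>M n)\<^sup>2 \<le> 2 * B"
      by (meson mult_left_mono of_nat_0_le_iff order_trans)
    then show ?thesis using that by (simp add: field_simps)
  qed
  obtain r N where r: "strict_mono r" and N: "unit_dist N"
    and conv: "\<And>h::real \<Rightarrow> real. continuous_on UNIV h \<Longrightarrow> (\<lambda>n. \<integral>t. h t \<partial>M (r n)) \<longlonglongrightarrow> (\<integral>t. h t \<partial>N)"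
    using unit_dist_seq_compact[of M] M by blast
  have F_zero: "(\<integral>t. F k t \<partial>N) = 0" for k
  proof -
    have "(\<lambda>n. 2 * B * (1 / real (r n))) \<longlonglongrightarrow> 2 * B * 0"
      by (intro tendsto_intros LIMSEQ_subseq_LIMSEQ[OF lim_1_over_n r, unfolded o_def])
    then have "(\<lambda>n. 2 * B / real (r n)) \<longlonglongrightarrow> 0" by simp
    moreover have "(\<lambda>n. (\<integral>t. F k t \<partial>M (r n))\<^sup>2) \<longlonglongrightarrow> (\<integral>t. F k t \<partial>N)\<^sup>2"
      by (intro tendsto_intros conv Fc)
    moreover have "\<exists>m. \<forall>n\<ge>m. (\<integral>t. F k t \<partial>M (r n))\<^sup>2 \<le> 2 * B / real (r n)"
    proof (intro exI[of _ "Suc k"] allI impI small)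
      fix n assume "Suc k \<le> n" then show "k < r n" using seq_suble[OF r, of n] by simp
    qed
    ultimately have "(\<integral>t. F k t \<partial>N)\<^sup>2 \<le> 0" using LIMSEQ_le by blast
    then show ?thesis by simp
  qed
  show ?thesis
  proof (rule that[OF N])
    fix f assume f: "f \<in> V"
    have "\<bar>\<integral>t. f t \<partial>N\<bar> \<le> 0 + e" if "e > 0" for e
    proof -
      obtain k where k: "\<forall>t\<in>{0..1}. \<bar>f t - F k t\<bar> < e" using Fd[OF f \<open>e > 0\<close>] by blast
      have "\<bar>\<integral>t. f t - F k t \<partial>N\<bar> \<le> e"
        by (rule unit_dist_integral_abs_le[OF N continuous_on_diff[OF Vc[OF f] Fc]])
           (use k in \<open>auto intro!: less_imp_le\<close>)
      then show ?thesis
        using F_zero[of k] unit_dist_integral_clamp(1)[OF N] Vc[OF f] Fc by simp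
    qed
    then show "(\<integral>t. f t \<partial>N) = 0" using field_le_epsilon[of "\<bar>\<integral>t. f t \<partial>N\<bar>" 0] by simp
  next
    fix e :: real assume "e > 0"
    then obtain n where n: "\<bar>(\<integral>t. l t \<partial>M (r n)) - (\<integral>t. l t \<partial>N)\<bar> < e"
      using LIMSEQ_D[OF conv[OF l]] by force
    \<comment> \<open>A single late stage suffices: its first-order inequality is the required one,
      with the action at that stage replaced by the limit at cost \<open>e\<close>.\<close>
    let ?f = "\<lambda>t. \<Sum>k<r n. (2 * real (r n) * (\<integral>t. F k t \<partial>M (r n))) * F k t"
    have "(\<integral>t. l t \<partial>N) - e \<le> l t + ?f t" if "t \<in> {0..1}" for t
      using fo[OF that, of "r n"] n by linarith
    then show "\<exists>f\<in>V. \<forall>t\<in>{0..1}. (\<integral>t. l t \<partial>N) - e \<le> l t + f t"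
      using sumV[where c="\<lambda>k. 2 * real (r n) * (\<integral>t. F k t \<partial>M (r n))" and n="r n"]
      by (intro bexI[of _ ?f]) auto
  qed
qed

subsection \<open>Schoenberg's space-filling curve\<close>

text \<open>Schoenberg's 2-periodic profile, 0 on [0,1/3] and 1 on [2/3,1]. A clamped cosine
  replaces the usual piecewise linear shape; the plateaus come from the cosine values 1/2 at pi/3
  and -1/2 at 2 pi/3.\<close>

definition zigzag :: "real \<Rightarrow> real" where
  "zigzag t = max 0 (min 1 (1/2 - cos (pi * t)))"

lemma zigzag_period: "zigzag (t + 2 * real n) = zigzag t"
proof -
  have "cos (pi * (t + 2 * real n)) = cos (pi * t + 2 * real n * pi)" by (simp add: algebra_simps)
  also have "\<dots> = cos (pi * t)" by (simp only: cos_add cos_2npi sin_2npi mult_1_right mult_zero_right diff_zero)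
  finally show ?thesis by (simp add: zigzag_def)
qed

lemma zigzag_eq_0: "0 \<le> t \<Longrightarrow> t \<le> 1/3 \<Longrightarrow> zigzag t = 0"
proof -
  assume t: "0 \<le> t" "t \<le> 1/3"
  have "cos (pi/3) \<le> cos (pi * t)"
    using t by (intro cos_monotone_0_pi_le) (auto simp: field_simps)
  then show ?thesis by (simp add: zigzag_def cos_60)
qed

lemma zigzag_eq_1: "2/3 \<le> t \<Longrightarrow> t \<le> 1 \<Longrightarrow> zigzag t = 1"
proof -
  assume t: "2/3 \<le> t" "t \<le> 1"
  have "cos (pi * t) \<le> cos (2 * (pi/3))"
    using t by (intro cos_monotone_0_pi_le) (auto simp: field_simps)
  also have "\<dots> = - 1/2" by (subst cos_double_cos) (simp add: cos_60 power2_eq_square)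
  finally show ?thesis by (simp add: zigzag_def)
qed

text \<open>Coordinate \<open>i\<close> of the curve in dimension \<open>m\<close>: the ternary
  digits 0 and 2 at the places congruent to \<open>i\<close> modulo \<open>m\<close> become the
  binary digits of that coordinate.\<close>

definition schoenberg :: "nat \<Rightarrow> nat \<Rightarrow> real \<Rightarrow> real" where
  "schoenberg m i t = (\<Sum>k. (1/2) ^ Suc k * zigzag (3 ^ (m * k + i) * t))"

lemma zigzag_bounds: "0 \<le> zigzag t" "zigzag t \<le> 1" by (auto simp: zigzag_def)

lemma half_powers_sums: "(\<lambda>k. (1/2::real) ^ Suc k) sums 1"
  using power_half_series by simp

lemma schoenberg_continuous: "continuous_on UNIV (schoenberg m i)"
proof -
  have "uniform_limit UNIV (\<lambda>n t. \<Sum>k<n. (1/2) ^ Suc k * zigzag (3 ^ (m * k + i) * t))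
      (schoenberg m i) sequentially"
    unfolding schoenberg_def
  proof (rule Weierstrass_m_test)
    show "summable (\<lambda>k. (1/2::real) ^ Suc k)" using half_powers_sums sums_summable by blast
    show "norm ((1/2) ^ Suc k * zigzag (3 ^ (m * k + i) * t)) \<le> (1/2) ^ Suc k" for k t
      using zigzag_bounds[of "3 ^ (m * k + i) * t"] by (simp add: abs_mult mult_left_le)
  qed
  then show ?thesis
    by (rule uniform_limit_theorem[rotated])
       (auto intro!: always_eventually continuous_intros simp: zigzag_def)
qed

lemma binary_expansion:
  fixes x :: real
  assumes "0 \<le> x" "x \<le> 1"
  obtains b :: "nat \<Rightarrow> nat" where "\<And>k. b k \<in> {0, 1}" "(\<lambda>k. (1/2) ^ Suc k * real (b k)) sums x"
proof (cases "x = 1")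
  \<comment> \<open>The floor construction below starts from \<open>q 0 = 0\<close>, which fails at
    1; there all digits are 1.\<close>
  case True
  then show ?thesis using that[of "\<lambda>_. 1"] half_powers_sums by simp
next
  case False
  then have x: "0 \<le> x" "x < 1" using assms by auto
  \<comment> \<open>\<open>q k\<close> is the integer formed by the first \<open>k\<close> binary
    digits; the digits are the differences \<open>q (Suc k) - 2 * q k\<close>, and their weighted
    sums telescope.\<close>
  define q where "q k = \<lfloor>2 ^ k * x\<rfloor>" for k :: nat
  have q: "q (Suc k) = 2 * q k \<or> q (Suc k) = 2 * q k + 1" for k
    unfolding q_def power_Suc by linarith
  define b where "b k = nat (q (Suc k) - 2 * q k)" for k
  have b: "b k \<in> {0, 1}" "real (b k) = q (Suc k) - 2 * q k" for k
    using q[of k] by (auto simp: b_def)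
  have q0: "q 0 = 0" using x by (simp add: q_def floor_eq_iff)
  have part: "(\<Sum>k<n. (1/2) ^ Suc k * real (b k)) = (1/2) ^ n * q n" for n
    by (induction n) (auto simp: q0 b(2) field_simps)
  have "(\<lambda>n. (1/2) ^ n * real_of_int (q n)) \<longlonglongrightarrow> x"
  proof (rule tendsto_sandwich)
    show "(\<lambda>n. x - (1/2)^n) \<longlonglongrightarrow> x"
      using tendsto_diff[OF tendsto_const[of x] LIMSEQ_power_zero[of "1/2::real"]] by simp
    show "\<forall>\<^sub>F n in sequentially. x - (1/2)^n \<le> (1/2) ^ n * real_of_int (q n)"
    proof (intro always_eventually allI)
      fix n
      have "2 ^ n * x - 1 \<le> q n" unfolding q_def by linarith
      then have "(1/2) ^ n * (2 ^ n * x - 1) \<le> (1/2) ^ n * q n" by (intro mult_left_mono) auto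
      then show "x - (1/2)^n \<le> (1/2) ^ n * real_of_int (q n)"
        by (simp add: right_diff_distrib power_one_over)
    qed
    show "\<forall>\<^sub>F n in sequentially. (1/2) ^ n * real_of_int (q n) \<le> x"
    proof (intro always_eventually allI)
      fix n
      have "q n \<le> 2 ^ n * x" unfolding q_def by linarith
      then show "(1/2) ^ n * real_of_int (q n) \<le> x" by (simp add: field_simps)
    qed
  qed simp
  then have "(\<lambda>k. (1/2) ^ Suc k * real (b k)) sums x" unfolding sums_def part .
  with b(1) show ?thesis by (rule that)
qed

text \<open>Base-3 expansions with digits 0 and 2: multiplying by \<open>3 ^ n\<close> shifts the digits and adds an
  even integer, which the 2-periodic zigzag ignores, so zigzag reads off the leading digit.\<close>
lemma ternary_digits:
  fixes a :: "nat \<Rightarrow> nat"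
  assumes a: "\<And>j. a j \<in> {0, 1}"
  obtains t where "t \<in> {0..1}" "\<And>n. zigzag (3 ^ n * t) = real (a n)"
proof -
  have third: "(\<lambda>j. 2 * (1/3::real) ^ Suc j) sums 1"
    using sums_mult[OF geometric_sums[of "1/3::real"], of "2/3"] by (simp add: field_simps)
  have nn: "0 \<le> 2 * real (a j) * (1/3::real) ^ Suc j'" for j j' by simp
  have le: "2 * real (a j) * (1/3::real) ^ Suc j' \<le> 2 * (1/3::real) ^ Suc j'" for j j'
    using a[of j] by auto
  have sm: "summable (\<lambda>j. 2 * real (a (j + n)) * (1/3::real) ^ Suc j)" for n
    by (rule summable_comparison_test'[OF sums_summable[OF third], of 0]) (use nn le in auto)
  \<comment> \<open>The number whose digits are those of \<open>a\<close> from place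
    \<open>n\<close> on.\<close>
  define T where "T n = (\<Sum>j. 2 * real (a (j + n)) * (1/3::real) ^ Suc j)" for n
  have T01: "0 \<le> T n" "T n \<le> 1" for n
    unfolding T_def using suminf_nonneg[OF sm nn] suminf_le[OF le sm sums_summable[OF third]]
      sums_unique[OF third] by auto
  have step: "3 * T n = 2 * real (a n) + T (Suc n)" for n
  proof -
    have "T n = (\<Sum>j. 2 * real (a (Suc j + n)) * (1/3::real) ^ Suc (Suc j)) + 2 * real (a n) * (1/3)"
      unfolding T_def using suminf_split_head[OF sm[of n]] by simp
    also have "(\<Sum>j. 2 * real (a (Suc j + n)) * (1/3::real) ^ Suc (Suc j))
       = (\<Sum>j. (1/3) * (2 * real (a (j + Suc n)) * (1/3::real) ^ Suc j))"
      by (simp add: algebra_simps)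
    also have "\<dots> = (1/3) * T (Suc n)" unfolding T_def by (rule suminf_mult[OF sm])
    finally show ?thesis by (simp add: field_simps)
  qed
  have shift: "\<exists>m. 3 ^ n * T 0 = T n + 2 * real m" for n
  proof (induction n)
    case 0 then show ?case by (intro exI[of _ 0]) simp
  next
    case (Suc n)
    then obtain m where "3 ^ n * T 0 = T n + 2 * real m" by blast
    then have "3 ^ Suc n * T 0 = T (Suc n) + 2 * real (a n + 3 * m)"
      using step[of n] by simp
    then show ?case by blast
  qed
  have "zigzag (3 ^ n * T 0) = real (a n)" for n
  proof -
    obtain m where "3 ^ n * T 0 = T n + 2 * real m" using shift by blast
    then have "zigzag (3 ^ n * T 0) = zigzag (T n)" by (simp add: zigzag_period)
    also have "\<dots> = real (a n)"
    proof (cases "a n = 0")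
      case True
      have "T n \<le> 1/3" using step[of n] T01[of "Suc n"] True by simp
      then show ?thesis using zigzag_eq_0 T01 True by simp
    next
      case False
      then have 1: "a n = 1" using a[of n] by auto
      have "2/3 \<le> T n" using step[of n] T01[of "Suc n"] 1 by simp
      then show ?thesis using zigzag_eq_1 T01 1 by simp
    qed
    finally show ?thesis .
  qed
  then show ?thesis using that[of "T 0"] T01[of 0] by auto
qed

lemma schoenberg_onto:
  fixes y :: "nat \<Rightarrow> real"
  assumes y: "\<And>i. i < m \<Longrightarrow> 0 \<le> y i \<and> y i \<le> 1"
  obtains t where "t \<in> {0..1}" "\<And>i. i < m \<Longrightarrow> schoenberg m i t = y i"
proof -
  have "\<exists>b::nat \<Rightarrow> nat. (\<forall>k. b k \<in> {0, 1}) \<and> (i < m \<longrightarrow> (\<lambda>k. (1/2) ^ Suc k * real (b k)) sums y i)" for i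
  proof (cases "i < m")
    case True
    then show ?thesis using binary_expansion[of "y i"] y[of i] by metis
  qed (auto intro!: exI[of _ "\<lambda>_. 0"])
  then obtain b :: "nat \<Rightarrow> nat \<Rightarrow> nat" where b: "\<And>i k. b i k \<in> {0, 1}"
    "\<And>i. i < m \<Longrightarrow> (\<lambda>k. (1/2) ^ Suc k * real (b i k)) sums y i" by metis
  \<comment> \<open>Interleaving: ternary place \<open>n\<close> serves coordinate
    \<open>n mod m\<close> at binary place \<open>n div m\<close>.\<close>
  obtain t where t: "t \<in> {0..1}" "\<And>n. zigzag (3 ^ n * t) = real (b (n mod m) (n div m))"
    using ternary_digits[of "\<lambda>n. b (n mod m) (n div m)"] b(1) by blast
  have "schoenberg m i t = y i" if i: "i < m" for i
  proof -
    have "schoenberg m i t = (\<Sum>k. (1/2) ^ Suc k * real (b i k))"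
      unfolding schoenberg_def t(2) using i by simp
    then show ?thesis using sums_unique[OF b(2)[OF i]] by simp
  qed
  with t(1) show ?thesis by (rule that)
qed

theorem space_filling_curve:
  fixes a b :: "'a::euclidean_space"
  obtains g :: "real \<Rightarrow> 'a" where "continuous_on UNIV g" "cbox a b \<subseteq> g ` {0..1}"
proof -
  let ?m = "DIM('a)"
  obtain e :: "'a \<Rightarrow> nat" where e: "bij_betw e Basis {..<?m}"
    using ex_bij_betw_finite_nat[OF finite_Basis] by (auto simp: atLeast0LessThan)
  define g where "g t = (\<Sum>i\<in>Basis. (a \<bullet> i + (b \<bullet> i - a \<bullet> i) * schoenberg ?m (e i) t) *\<^sub>R i)" for t
  have gi: "g t \<bullet> i = a \<bullet> i + (b \<bullet> i - a \<bullet> i) * schoenberg ?m (e i) t" if "i \<in> Basis" for i t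
    using that by (simp add: g_def)
  show ?thesis
  proof (rule that)
    show "continuous_on UNIV g" unfolding g_def
      by (intro continuous_intros schoenberg_continuous)
    show "cbox a b \<subseteq> g ` {0..1}"
    proof
      fix x assume x: "x \<in> cbox a b"
      \<comment> \<open>On a degenerate side of the box, division by 0 yields
        \<open>c i = 0\<close>, which is still a correct parameter.\<close>
      define c where "c i = (x \<bullet> i - a \<bullet> i) / (b \<bullet> i - a \<bullet> i)" for i
      have c: "0 \<le> c i \<and> c i \<le> 1" "a \<bullet> i + (b \<bullet> i - a \<bullet> i) * c i = x \<bullet> i" if "i \<in> Basis" for i
      proof -
        have xi: "a \<bullet> i \<le> x \<bullet> i" "x \<bullet> i \<le> b \<bullet> i" using x that by (auto simp: mem_box)
        show "0 \<le> c i \<and> c i \<le> 1" using xi by (auto simp: c_def divide_le_eq)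
        show "a \<bullet> i + (b \<bullet> i - a \<bullet> i) * c i = x \<bullet> i" using xi by (simp add: c_def)
      qed
      have inv: "inv_into Basis e j \<in> Basis" if "j < ?m" for j
        using e that by (simp add: bij_betw_def inv_into_into)
      obtain t where t: "t \<in> {0..1}" "\<And>j. j < ?m \<Longrightarrow> schoenberg ?m j t = c (inv_into Basis e j)"
        using schoenberg_onto[of ?m "\<lambda>j. c (inv_into Basis e j)"] c(1) inv by blast
      have "g t = x"
      proof (rule euclidean_eqI)
        fix i :: 'a assume i: "i \<in> Basis"
        have "e i < ?m" using e i by (auto simp: bij_betw_def)
        then have "schoenberg ?m (e i) t = c i"
          using t(2) e i by (simp add: bij_betw_def inv_into_f_f)
        then show "g t \<bullet> i = x \<bullet> i" using gi[OF i] c(2)[OF i] by simp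
      qed
      then show "x \<in> g ` {0..1}" using t(1) by blast
    qed
  qed
qed

subsection \<open>Periodic test functions and Hadamard differentials\<close>

text \<open>The direction varies together with the step, so the Frechet remainder must be uniform in
  \<open>w'\<close>. It is, because \<open>w'\<close> near \<open>w\<close> stays in the ball of
  radius \<open>b = norm w + 1\<close>.\<close>

lemma hadamard_quotient_tendsto:
  fixes f :: "'a::real_normed_vector \<Rightarrow> real"
  assumes "(f has_derivative D) (at x)"
  shows "((\<lambda>(h, w'). (f (x + h *\<^sub>R w') - f x) / h) \<longlongrightarrow> D w) (at_right 0 \<times>\<^sub>F nhds w)"
proof (rule tendstoI)
  fix e :: real assume e: "e > 0"
  interpret D: bounded_linear D using assms by (rule has_derivative_bounded_linear)
  define b where "b = norm w + 1"
  have b: "b > 0" by (simp add: b_def add_nonneg_pos)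
  then obtain d where d: "d > 0"
    "\<And>y. norm (y - x) < d \<Longrightarrow> \<bar>f y - f x - D (y - x)\<bar> \<le> e / (2 * b) * norm (y - x)"
    using assms e unfolding has_derivative_at_alt by (auto dest!: spec[of _ "e / (2 * b)"])
  have "\<forall>\<^sub>F h in at_right (0::real). 0 < h \<and> h < d / b"
    using d b by (auto simp: eventually_at_right_field intro!: exI[of _ "d / b"])
  moreover have "\<forall>\<^sub>F w' in nhds w. dist (D w') (D w) < e / 2"
    using e by (intro tendstoD[OF D.tendsto[OF filterlim_ident]]) auto
  moreover have "\<forall>\<^sub>F w' in nhds w. dist w' w < 1"
    by (intro tendstoD[OF filterlim_ident]) auto
  ultimately have "\<forall>\<^sub>F (h, w') in at_right 0 \<times>\<^sub>F nhds w.
      (0 < h \<and> h < d / b) \<and> (dist (D w') (D w) < e / 2 \<and> dist w' w < 1)"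
    unfolding case_prod_beta by (intro eventually_prodI eventually_conj[of _ "nhds w"])
  then show "\<forall>\<^sub>F p in at_right 0 \<times>\<^sub>F nhds w.
      dist (case p of (h, w') \<Rightarrow> (f (x + h *\<^sub>R w') - f x) / h) (D w) < e"
  proof (rule eventually_mono, clarify)
    fix h w' assume h: "0 < h" "h < d / b" and w': "dist (D w') (D w) < e / 2" "dist w' w < 1"
    have nw: "norm w' < b" using w'(2) norm_triangle_sub[of w' w] by (simp add: b_def dist_norm)
    have "norm (x + h *\<^sub>R w' - x) < d"
    proof -
      have "h * norm w' \<le> h * b" using h nw by (intro mult_left_mono) auto
      also have "\<dots> < d" using h b by (simp add: field_simps)
      finally show ?thesis using h by simp
    qed
    then have "\<bar>f (x + h *\<^sub>R w') - f x - h * D w'\<bar> \<le> e / (2 * b) * (h * norm w')"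
      using d(2)[of "x + h *\<^sub>R w'"] h by (simp add: D.scaleR)
    also have "\<dots> \<le> e / (2 * b) * (h * b)" using h e b nw by (intro mult_left_mono) auto
    finally have *: "\<bar>f (x + h *\<^sub>R w') - f x - h * D w'\<bar> \<le> e / 2 * h" using b by simp
    have "(f (x + h *\<^sub>R w') - f x) / h - D w' = (f (x + h *\<^sub>R w') - f x - h * D w') / h"
      using h by (simp add: field_simps)
    then have "\<bar>(f (x + h *\<^sub>R w') - f x) / h - D w'\<bar> \<le> e / 2"
      using * h by (simp add: pos_divide_le_eq)
    then show "dist ((f (x + h *\<^sub>R w') - f x) / h) (D w) < e"
      using w'(1) unfolding dist_real_def by linarith
  qed
qed

lemma at_right_prod_nhds_neq_bot: "at_right (0::real) \<times>\<^sub>F nhds w \<noteq> bot"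
  by (simp add: prod_filter_eq_bot)

text \<open>Up to a constant \<open>\<psi>\<close> touches \<open>\<phi>\<close> from below at
  \<open>x\<close>, so its difference quotients, which converge to \<open>p \<bullet> w\<close>, lie
  below those of \<open>\<phi>\<close>.\<close>

lemma hsubdiff_of_minimum:
  assumes D: "(\<psi> has_derivative (\<bullet>) p) (at x)" and min: "\<And>y. \<phi> x - \<psi> x \<le> \<phi> y - \<psi> y"
  shows "p \<in> hsubdiff \<phi> x"
  unfolding hsubdiff_def
proof (intro CollectI allI)
  fix w :: "real^'a"
  let ?F = "at_right (0::real) \<times>\<^sub>F nhds w"
  have "ereal (p \<bullet> w) = Liminf ?F (\<lambda>(h, w'). ereal ((\<psi> (x + h *\<^sub>R w') - \<psi> x) / h))"
    using hadamard_quotient_tendsto[OF D, of w]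
    by (intro lim_imp_Liminf[symmetric] at_right_prod_nhds_neq_bot) (auto simp: case_prod_unfold)
  also have "\<dots> \<le> Liminf ?F (\<lambda>(h, w'). ereal ((\<phi> (x + h *\<^sub>R w') - \<phi> x) / h))"
  proof (rule Liminf_mono)
    have "\<forall>\<^sub>F (h, w') in ?F. 0 < h \<and> True"
      unfolding case_prod_beta by (intro eventually_prodI) (auto simp: eventually_at_right_less)
    then show "\<forall>\<^sub>F p in ?F. (case p of (h, w') \<Rightarrow> ereal ((\<psi> (x + h *\<^sub>R w') - \<psi> x) / h))
        \<le> (case p of (h, w') \<Rightarrow> ereal ((\<phi> (x + h *\<^sub>R w') - \<phi> x) / h))"
    proof (rule eventually_mono, clarify)
      fix h :: real and w' assume "0 < h"
      then show "ereal ((\<psi> (x + h *\<^sub>R w') - \<psi> x) / h) \<le> ereal ((\<phi> (x + h *\<^sub>R w') - \<phi> x) / h)"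
        using min[of "x + h *\<^sub>R w'"] by (simp add: divide_right_mono)
    qed
  qed
  finally show "ereal (p \<bullet> w) \<le> Liminf ?F (\<lambda>(h, w'). ereal ((\<phi> (x + h *\<^sub>R w') - \<phi> x) / h))" .
qed

lemma hsupdiff_of_maximum:
  assumes D: "(\<psi> has_derivative (\<bullet>) p) (at x)" and max: "\<And>y. \<phi> y - \<psi> y \<le> \<phi> x - \<psi> x"
  shows "p \<in> hsupdiff \<phi> x"
  unfolding hsupdiff_def
proof (intro CollectI allI)
  fix w :: "real^'a"
  let ?F = "at_right (0::real) \<times>\<^sub>F nhds w"
  have "Limsup ?F (\<lambda>(h, w'). ereal ((\<phi> (x + h *\<^sub>R w') - \<phi> x) / h))
      \<le> Limsup ?F (\<lambda>(h, w'). ereal ((\<psi> (x + h *\<^sub>R w') - \<psi> x) / h))"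
  proof (rule Limsup_mono)
    have "\<forall>\<^sub>F (h, w') in ?F. 0 < h \<and> True"
      unfolding case_prod_beta by (intro eventually_prodI) (auto simp: eventually_at_right_less)
    then show "\<forall>\<^sub>F p in ?F. (case p of (h, w') \<Rightarrow> ereal ((\<phi> (x + h *\<^sub>R w') - \<phi> x) / h))
        \<le> (case p of (h, w') \<Rightarrow> ereal ((\<psi> (x + h *\<^sub>R w') - \<psi> x) / h))"
    proof (rule eventually_mono, clarify)
      fix h :: real and w' assume "0 < h"
      then show "ereal ((\<phi> (x + h *\<^sub>R w') - \<phi> x) / h) \<le> ereal ((\<psi> (x + h *\<^sub>R w') - \<psi> x) / h)"
        using max[of "x + h *\<^sub>R w'"] by (simp add: divide_right_mono)
    qed
  qed
  also have "\<dots> = ereal (p \<bullet> w)"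
    using hadamard_quotient_tendsto[OF D, of w]
    by (intro lim_imp_Limsup at_right_prod_nhds_neq_bot) (auto simp: case_prod_unfold)
  finally show "Limsup ?F (\<lambda>(h, w'). ereal ((\<phi> (x + h *\<^sub>R w') - \<phi> x) / h)) \<le> ereal (p \<bullet> w)" .
qed

section \<open>Periodicity and the class of test functions\<close>

definition wrap :: "real^'n \<Rightarrow> real^'n" where
  "wrap x = (\<chi> i. frac (x $ i))"

lemma wrap_in_fund_dom: "wrap x \<in> fund_dom"
  by (simp add: wrap_def fund_dom_def frac_lt_1)

lemma wrap_in_cube: "wrap x \<in> cbox 0 1"
  by (simp add: wrap_def mem_box_cart frac_lt_1 less_imp_le)

lemma zperiodic_wrap: "zperiodic f \<Longrightarrow> f (wrap x) = f x"
proof -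
  assume "zperiodic f"
  then have "f (wrap x + (\<chi> i. of_int \<lfloor>x $ i\<rfloor>)) = f (wrap x)" by (simp add: zperiodic_def)
  moreover have "wrap x + (\<chi> i. of_int \<lfloor>x $ i\<rfloor>) = x" by (simp add: wrap_def vec_eq_iff frac_def)
  ultimately show ?thesis by simp
qed

lemma wrap_measurable: "wrap \<in> borel_measurable borel"
proof (subst borel_measurable_euclidean_space, intro ballI)
  fix b :: "real^'n" assume "b \<in> Basis"
  then obtain i where "b = axis i 1" by (auto simp: Basis_vec_def)
  then show "(\<lambda>x. wrap x \<bullet> b) \<in> borel_measurable borel"
    by (simp add: wrap_def inner_axis frac_def)
qed

lemma zperiodic_attains_min:
  fixes f :: "real^'n \<Rightarrow> real"
  assumes "zperiodic f" "continuous_on UNIV f"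
  obtains x0 where "\<And>x. f x0 \<le> f x"
proof -
  have "cbox 0 1 \<noteq> ({} :: (real^'n) set)" using wrap_in_cube by blast
  then obtain x0 where "\<forall>x\<in>cbox 0 1. f x0 \<le> f x"
    using continuous_attains_inf[OF compact_cbox _ continuous_on_subset[OF assms(2) subset_UNIV]]
    by blast
  then have "f x0 \<le> f x" for x using zperiodic_wrap[OF assms(1), of x] wrap_in_cube[of x] by metis
  then show ?thesis by (rule that)
qed

lemma zperiodic_bounded:
  fixes f :: "real^'n \<Rightarrow> real"
  assumes "zperiodic f" "continuous_on UNIV f"
  obtains B where "\<And>x. \<bar>f x\<bar> \<le> B"
proof -
  obtain a where a: "\<And>x. f a \<le> f x" using zperiodic_attains_min[OF assms] by blast
  have "zperiodic (\<lambda>x. - f x)" using assms(1) by (simp add: zperiodic_def)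
  then obtain b where b: "\<And>x. - f b \<le> - f x"
    using zperiodic_attains_min[of "\<lambda>x. - f x"] assms(2) continuous_on_minus by blast
  have "\<bar>f x\<bar> \<le> \<bar>f a\<bar> + \<bar>f b\<bar>" for x using a[of x] b[of x] by linarith
  then show ?thesis by (rule that)
qed

text \<open>The test functions of \<open>holonomic\<close>, carried together with their
  derivative.\<close>

definition c1_periodic :: "(real^'n \<Rightarrow> real) \<Rightarrow> (real^'n \<Rightarrow> real^'n \<Rightarrow> real) \<Rightarrow> bool" where
  "c1_periodic \<psi> D \<longleftrightarrow> zperiodic \<psi> \<and> (\<forall>x. (\<psi> has_derivative D x) (at x)) \<and>
     (\<forall>v. continuous_on UNIV (\<lambda>x. D x v))"

lemma c1_periodic_linear: "c1_periodic \<psi> D \<Longrightarrow> bounded_linear (D x)"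
  by (metis c1_periodic_def has_derivative_bounded_linear)

lemma c1_periodic_gradient:
  assumes "c1_periodic \<psi> D"
  shows "D x v = (\<chi> i. D x (axis i 1)) \<bullet> v"
proof -
  interpret bounded_linear "D x" by (rule c1_periodic_linear[OF assms])
  have "D x v = D x (\<Sum>i\<in>UNIV. (v $ i) *\<^sub>R axis i 1)" using basis_expansion[of v] by (simp add: scalar_mult_eq_scaleR)
  then show ?thesis by (simp add: sum scaleR inner_vec_def mult.commute)
qed

text \<open>Linearity in \<open>v\<close> reduces \<open>D\<close> to finitely many partial
  derivatives, so continuity in \<open>x\<close> at each fixed \<open>v\<close> already gives joint
  continuity.\<close>

lemma c1_periodic_continuous:
  assumes "c1_periodic \<psi> D"
  shows "continuous_on UNIV (\<lambda>z. D (fst z) (snd z))"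
proof -
  have *: "continuous_on UNIV (\<lambda>z::(real^'a) \<times> (real^'a). D (fst z) v)" for v
    using assms by (intro continuous_on_compose2[of UNIV "\<lambda>x. D x v" _ fst] continuous_intros)
      (auto simp: c1_periodic_def)
  show ?thesis
    by (subst c1_periodic_gradient[OF assms]) (intro continuous_intros *)
qed

text \<open>Integer translations fix \<open>\<psi>\<close>, hence also its derivative by
  uniqueness.\<close>

lemma c1_periodic_D_periodic:
  assumes "c1_periodic \<psi> D"
  shows "zperiodic (\<lambda>x. D x v)"
  unfolding zperiodic_def
proof (intro allI impI)
  fix x k :: "real^'a" assume k: "\<forall>i. k $ i \<in> \<int>"
  have "(\<psi> has_derivative D (x + k)) (at (x + k))" using assms by (simp add: c1_periodic_def)
  then have "((\<lambda>y. \<psi> (y + k)) has_derivative D (x + k)) (at x)"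
    using has_derivative_compose[of "\<lambda>y. y + k" "\<lambda>y. y" x UNIV \<psi> "D (x + k)"]
      has_derivative_add_const[OF has_derivative_ident, of k "at x"]
    by simp
  moreover have "(\<lambda>y. \<psi> (y + k)) = \<psi>" using assms k by (auto simp: c1_periodic_def zperiodic_def)
  ultimately have "D (x + k) = D x"
    using has_derivative_unique assms by (metis c1_periodic_def)
  then show "D (x + k) v = D x v" by simp
qed

text \<open>Dominates \<open>D\<close> by a multiple of \<open>norm v\<close>, which every holonomic
  measure integrates.\<close>

lemma c1_periodic_bounded:
  assumes "c1_periodic \<psi> D"
  obtains B where "\<And>x v. \<bar>D x v\<bar> \<le> B * norm v"
proof -
  define G where "G x = norm (\<chi> i. D x (axis i 1))" for x
  have "zperiodic G" using c1_periodic_D_periodic[OF assms] by (simp add: G_def zperiodic_def)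
  moreover have "continuous_on UNIV G"
    unfolding G_def using assms by (intro continuous_intros) (auto simp: c1_periodic_def)
  ultimately obtain B where B: "\<And>x. \<bar>G x\<bar> \<le> B" using zperiodic_bounded by blast
  have "\<bar>D x v\<bar> \<le> B * norm v" for x v
  proof -
    have "\<bar>D x v\<bar> \<le> G x * norm v"
      unfolding c1_periodic_gradient[OF assms, of x v] G_def by (rule Cauchy_Schwarz_ineq2)
    also have "\<dots> \<le> B * norm v" using B[of x] by (intro mult_right_mono) auto
    finally show ?thesis .
  qed
  then show ?thesis by (rule that)
qed

lemma c1_periodic_zero: "c1_periodic (\<lambda>_. 0) (\<lambda>_ _. 0)"
  by (simp add: c1_periodic_def zperiodic_def)

lemma c1_periodic_add:
  "c1_periodic \<psi> D \<Longrightarrow> c1_periodic \<psi>' D' \<Longrightarrow> c1_periodic (\<lambda>x. \<psi> x + \<psi>' x) (\<lambda>x v. D x v + D' x v)"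
  by (auto simp: c1_periodic_def zperiodic_def intro!: has_derivative_add continuous_on_add)

lemma c1_periodic_mult:
  "c1_periodic \<psi> D \<Longrightarrow> c1_periodic (\<lambda>x. c * \<psi> x) (\<lambda>x v. c * D x v)"
  by (auto simp: c1_periodic_def zperiodic_def intro!: has_derivative_mult_right continuous_on_mult_left)

subsection \<open>Mollification\<close>

text \<open>Squaring the positive part removes its kink at 0; this is what makes \<open>bump\<close>
  continuously differentiable.\<close>

lemma posprt_square_deriv: "((\<lambda>s::real. (max 0 s)\<^sup>2) has_real_derivative 2 * max 0 s) (at s)"
proof (cases s "0::real" rule: linorder_cases)
  case less
  have "((\<lambda>s::real. 0) has_real_derivative 2 * max 0 s) (at s)" using less by simp
  then show ?thesis
    by (rule DERIV_cong_ev[THEN iffD1, rotated -1, OF _ refl _ refl])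
       (use less in \<open>auto simp: eventually_nhds intro!: exI[of _ "{..<0}"]\<close>)
next
  case greater
  have "((\<lambda>s::real. s\<^sup>2) has_real_derivative 2 * max 0 s) (at s)"
    using greater by (auto intro!: derivative_eq_intros)
  then show ?thesis
    by (rule DERIV_cong_ev[THEN iffD1, rotated -1, OF _ refl _ refl])
       (use greater in \<open>auto simp: eventually_nhds intro!: exI[of _ "{0<..}"]\<close>)
next
  case equal
  have "((\<lambda>h. (max 0 h)\<^sup>2 / h) \<longlongrightarrow> 0) (at (0::real))"
  proof (rule Lim_null_comparison)
    show "\<forall>\<^sub>F h in at (0::real). norm ((max 0 h)\<^sup>2 / h) \<le> \<bar>h\<bar>"
      by (intro always_eventually allI) (auto simp: max_def power2_eq_square)
    show "((\<lambda>h. \<bar>h\<bar>) \<longlongrightarrow> 0) (at (0::real))"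
      using tendsto_rabs[OF tendsto_ident_at, of "0::real" UNIV] by simp
  qed
  then show ?thesis using equal by (simp add: DERIV_def)
qed

text \<open>A C^1 mollifying kernel supported in the ball of radius \<open>e\<close>, left
  unnormalised; its mass is divided out in the mollification.\<close>

definition bump :: "real \<Rightarrow> real^'n \<Rightarrow> real" where
  "bump e z = (max 0 (e\<^sup>2 - z \<bullet> z))\<^sup>2"

lemma bump_nonneg: "0 \<le> bump e z" by (simp add: bump_def)

lemma bump_eq_0: "e > 0 \<Longrightarrow> e \<le> norm z \<Longrightarrow> bump e z = 0"
  using power_mono[of e "norm z" 2] by (simp add: bump_def dot_square_norm)

lemma bump_deriv:
  "(bump e has_derivative (\<lambda>v. ((- 4 * max 0 (e\<^sup>2 - z \<bullet> z)) *\<^sub>R z) \<bullet> v)) (at z)"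
proof -
  have "((\<lambda>z. e\<^sup>2 - z \<bullet> z) has_derivative (\<lambda>v. - (2 * (z \<bullet> v)))) (at z)"
    by (auto intro!: derivative_eq_intros simp: inner_commute)
  from has_derivative_compose[OF this posprt_square_deriv[unfolded has_field_derivative_def]]
  show ?thesis by (simp add: bump_def[abs_def] algebra_simps)
qed

lemma bump_continuous: "continuous_on S (bump e)"
  unfolding bump_def by (intro continuous_intros)

lemma integrable_bump_mult:
  fixes f :: "real^'n \<Rightarrow> real"
  assumes "e > 0" "continuous_on UNIV f"
  shows "integrable lborel (\<lambda>z. bump e (z - x) * f z)"
proof -
  have "integrable lborel (\<lambda>z. indicator (cball x e) z *\<^sub>R (bump e (z - x) * f z))"
    by (intro borel_integrable_compact compact_cball continuous_intros
          continuous_on_compose2[OF bump_continuous] continuous_on_subset[OF assms(2)]) auto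
  moreover have "(\<lambda>z. indicator (cball x e) z *\<^sub>R (bump e (z - x) * f z)) = (\<lambda>z. bump e (z - x) * f z)"
  proof
    fix z
    show "indicator (cball x e) z *\<^sub>R (bump e (z - x) * f z) = bump e (z - x) * f z"
      using bump_eq_0[OF assms(1), of "z - x"]
      by (cases "z \<in> cball x e") (auto simp: dist_norm norm_minus_commute)
  qed
  ultimately show ?thesis by simp
qed

lemma integral_bump_pos:
  assumes "e > 0"
  shows "(\<integral>z. bump e z \<partial>(lborel :: (real^'n) measure)) > 0"
proof -
  \<comment> \<open>The value of the bump at radius \<open>e / 2\<close>, hence a lower bound on the
    ball of that radius.\<close>
  define c where "c = ((e\<^sup>2 - (e/2)\<^sup>2))\<^sup>2"
  have c: "c > 0" using assms by (simp add: c_def power2_eq_square)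
  have int: "integrable lborel (bump e :: real^'n \<Rightarrow> real)"
    using integrable_bump_mult[OF assms, of "\<lambda>_. 1" 0] by simp
  have "0 < c * measure lborel (ball (0::real^'n) (e/2))"
    using c content_ball_pos[of "e/2" "0::real^'n"] assms by simp
  also have "\<dots> = (\<integral>z. c * indicator (ball 0 (e/2)) z \<partial>(lborel :: (real^'n) measure))"
    by simp
  also have "\<dots> \<le> (\<integral>z. bump e z \<partial>(lborel :: (real^'n) measure))"
  proof (rule integral_mono)
    show "integrable lborel (bump e :: real^'n \<Rightarrow> real)" by (rule int)
    show "integrable lborel (\<lambda>z::real^'n. c * indicator (ball 0 (e/2)) z)"
      by (intro integrable_mult_right integrable_real_indicator emeasure_lborel_ball_finite) auto
    fix z :: "real^'n"
    show "c * indicator (ball 0 (e/2)) z \<le> bump e z"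
    proof (cases "z \<in> ball 0 (e/2)")
      case True
      then have "z \<bullet> z \<le> (e/2)\<^sup>2" by (simp add: dot_square_norm power_mono less_imp_le del: power_divide)
      then have "e\<^sup>2 - (e/2)\<^sup>2 \<le> max 0 (e\<^sup>2 - z \<bullet> z)" by linarith
      moreover have "0 \<le> e\<^sup>2 - (e/2)\<^sup>2" using assms by (simp add: power2_eq_square)
      ultimately show ?thesis using True power_mono by (simp add: c_def bump_def)
    qed (simp add: bump_nonneg)
  qed
  finally show ?thesis .
qed

text \<open>The Leibniz rule wants one fixed compact domain of integration. While \<open>x\<close>
  stays within distance 1 of \<open>x0\<close>, all kernels are supported in the ball of radius
  \<open>1 + e\<close>, so one box serves them all; hence the local form.\<close>

lemma bump_convolution_local_C1:
  fixes f :: "real^'n \<Rightarrow> real"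
  assumes e: "e > 0" and f: "continuous_on UNIV f"
  shows "\<exists>G::real^'n \<Rightarrow> (real^'n) \<Rightarrow>\<^sub>L real. continuous_on (ball x0 1) G \<and>
    (\<forall>x\<in>ball x0 1. ((\<lambda>x. \<integral>z. bump e (z - x) * f z \<partial>lborel) has_derivative blinfun_apply (G x)) (at x))"
proof -
  let ?U = "ball x0 1"
  obtain a b where ab: "cball x0 (1 + e) \<subseteq> cbox a b"
    using bounded_subset_cbox_symmetric[OF bounded_cball] by metis
  \<comment> \<open>The derivative of the integrand in \<open>x\<close>; the inner derivative of
    \<open>z - x\<close> turns the factor -4 of the bump into 4.\<close>
  define fx where "fx x z = blinfun_inner_right (f z *\<^sub>R ((4 * max 0 (e\<^sup>2 - (z - x) \<bullet> (z - x))) *\<^sub>R (z - x)))" for x z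
  define G where "G x = integral (cbox a b) (fx x)" for x
  have eq: "(\<integral>z. bump e (z - x) * f z \<partial>lborel) = integral (cbox a b) (\<lambda>z. bump e (z - x) * f z)"
    and int: "(\<lambda>z. bump e (z - x) * f z) integrable_on cbox a b" if x: "x \<in> ?U" for x
  proof -
    have cont: "continuous_on (cbox a b) (\<lambda>z. bump e (z - x) * f z)"
      by (intro continuous_intros continuous_on_compose2[OF bump_continuous] continuous_on_subset[OF f]) auto
    then show "(\<lambda>z. bump e (z - x) * f z) integrable_on cbox a b" by (rule integrable_continuous)
    have si: "set_integrable lborel (cbox a b) (\<lambda>z. bump e (z - x) * f z)"
      unfolding set_integrable_def by (intro borel_integrable_compact compact_cbox cont)
    have "indicator (cbox a b) z *\<^sub>R (bump e (z - x) * f z) = bump e (z - x) * f z" for z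
    proof (cases "z \<in> cbox a b")
      case False
      then have "1 + e < dist x0 z" using ab by (metis mem_cball not_le subsetD)
      then have "e \<le> norm (z - x)"
        using x dist_triangle[of x0 z x] by (simp add: dist_norm norm_minus_commute)
      then show ?thesis using bump_eq_0[OF e, of "z - x"] by simp
    qed simp
    then have "(\<integral>z. bump e (z - x) * f z \<partial>lborel) = (LINT z:cbox a b|lborel. bump e (z - x) * f z)"
      by (simp only: set_lebesgue_integral_def)
    also have "\<dots> = integral (cbox a b) (\<lambda>z. bump e (z - x) * f z)"
      by (rule set_borel_integral_eq_integral(2)[OF si])
    finally show "(\<integral>z. bump e (z - x) * f z \<partial>lborel) = integral (cbox a b) (\<lambda>z. bump e (z - x) * f z)" .
  qed
  have fxc: "continuous_on (?U \<times> cbox a b) (\<lambda>(x, z). fx x z)"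
    unfolding fx_def case_prod_unfold
    by (intro continuous_intros bounded_linear.continuous_on[OF bounded_linear_blinfun_inner_right]
          continuous_on_compose2[OF f]) auto
  show ?thesis
  proof (intro exI[of _ G] conjI ballI)
    show "continuous_on ?U G" unfolding G_def by (rule integral_continuous_on_param[OF fxc])
    fix x assume x: "x \<in> ?U"
    have "((\<lambda>x. integral (cbox a b) (\<lambda>z. bump e (z - x) * f z)) has_derivative blinfun_apply (G x)) (at x within ?U)"
      unfolding G_def
    proof (rule leibniz_rule[OF _ int fxc x convex_ball])
      fix x z
      have "((\<lambda>x. z - x) has_derivative uminus) (at x within ?U)"
        by (auto intro!: derivative_eq_intros)
      from has_derivative_mult_left[OF has_derivative_compose[OF this bump_deriv], of e "f z"]
      show "((\<lambda>x. bump e (z - x) * f z) has_derivative blinfun_apply (fx x z)) (at x within ?U)"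
        by (rule has_derivative_eq_rhs) (auto simp: fx_def algebra_simps)
    qed
    then have "((\<lambda>x. integral (cbox a b) (\<lambda>z. bump e (z - x) * f z)) has_derivative blinfun_apply (G x)) (at x)"
      using at_within_open[OF x open_ball] by simp
    then show "((\<lambda>x. \<integral>z. bump e (z - x) * f z \<partial>lborel) has_derivative blinfun_apply (G x)) (at x)"
      by (rule has_derivative_transform_within_open[OF _ open_ball x]) (simp add: eq)
  qed
qed

lemma integral_lborel_shift:
  fixes f :: "'a::euclidean_space \<Rightarrow> real"
  assumes [measurable]: "f \<in> borel_measurable borel"
  shows "(\<integral>z. f (x + z) \<partial>lborel) = (\<integral>z. f z \<partial>lborel)"
proof -
  have "(\<integral>z. f z \<partial>lborel) = (\<integral>z. f z \<partial>distr lborel borel ((+) x))" by (simp add: lborel_distr_plus)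
  also have "\<dots> = (\<integral>z. f (x + z) \<partial>lborel)" by (subst integral_distr) auto
  finally show ?thesis by simp
qed

text \<open>Averaging with a nonnegative kernel preserves one-sided increment bounds: if points
  within \<open>e\<close> of \<open>x\<close> lose at most \<open>c * T\<close> along
  \<open>v\<close>, so does the mollified function at \<open>x\<close>. Letting \<open>T\<close>
  tend to 0 turns this into a bound on the derivative.\<close>

theorem smooth_approximation:
  fixes \<phi> :: "real^'n \<Rightarrow> real"
  assumes per: "zperiodic \<phi>" and cont: "continuous_on UNIV \<phi>" and e: "e > 0"
  obtains \<psi> D where "c1_periodic \<psi> D"
    "\<And>x v c \<tau>. \<tau> > 0 \<Longrightarrow> (\<And>y T. norm (y - x) \<le> e \<Longrightarrow> 0 \<le> T \<Longrightarrow> T \<le> \<tau> \<Longrightarrow> \<phi> y - c * T \<le> \<phi> (y + T *\<^sub>R v))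
       \<Longrightarrow> - c \<le> D x v"
proof -
  define I where "I = (\<integral>z. bump e z \<partial>(lborel :: (real^'n) measure))"
  have I: "I > 0" unfolding I_def by (rule integral_bump_pos[OF e])
  define \<psi>0 where "\<psi>0 x = (\<integral>z. bump e (z - x) * \<phi> z \<partial>lborel)" for x
  define \<psi> where "\<psi> x = \<psi>0 x / I" for x
  define D where "D x = frechet_derivative \<psi> (at x)" for x
  \<comment> \<open>With the kernel moving, the integral is differentiable; with
    \<open>\<phi>\<close> moving, it inherits periodicity and increment bounds.\<close>
  have \<psi>0: "\<psi>0 x = (\<integral>z. bump e z * \<phi> (x + z) \<partial>lborel)" for x
  proof -
    have "(\<lambda>z. bump e (z - x) * \<phi> z) \<in> borel_measurable borel"
      by (intro borel_measurable_continuous_onI continuous_intros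
          continuous_on_compose2[OF bump_continuous] cont) auto
    from integral_lborel_shift[OF this, of x] show ?thesis by (simp add: \<psi>0_def)
  qed
  have C1: "\<exists>G::real^'n \<Rightarrow> (real^'n) \<Rightarrow>\<^sub>L real. continuous_on (ball x0 1) G \<and>
     (\<forall>x\<in>ball x0 1. (\<psi> has_derivative (\<lambda>v. blinfun_apply (G x) v / I)) (at x))" for x0
  proof -
    obtain G :: "real^'n \<Rightarrow> (real^'n) \<Rightarrow>\<^sub>L real" where G: "continuous_on (ball x0 1) G"
      "\<forall>x\<in>ball x0 1. (\<psi>0 has_derivative blinfun_apply (G x)) (at x)"
      using bump_convolution_local_C1[OF e cont, of x0, folded \<psi>0_def] by blast
    show ?thesis unfolding \<psi>_def using G I
      by (intro exI[of _ G]) (auto intro!: bounded_linear.has_derivative[OF bounded_linear_divide])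
  qed
  have D: "(\<psi> has_derivative D x) (at x)" for x
  proof -
    obtain G where "\<forall>y\<in>ball x 1. (\<psi> has_derivative (\<lambda>v. blinfun_apply (G y) v / I)) (at y)" using C1[of x] by blast
    then have "\<psi> differentiable (at x)" unfolding differentiable_def by (meson centre_in_ball zero_less_one)
    then show ?thesis unfolding D_def by (simp add: frechet_derivative_works)
  qed
  have Dc: "continuous_on UNIV (\<lambda>x. D x v)" for v
  proof (rule continuous_at_imp_continuous_on, rule ballI)
    fix x0
    obtain G :: "real^'n \<Rightarrow> (real^'n) \<Rightarrow>\<^sub>L real" where G: "continuous_on (ball x0 1) G"
      "\<forall>x\<in>ball x0 1. (\<psi> has_derivative (\<lambda>v. blinfun_apply (G x) v / I)) (at x)" using C1[of x0] by blast
    have "D x v = blinfun_apply (G x) v / I" if "x \<in> ball x0 1" for x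
      using has_derivative_unique[OF D] G(2) that by metis
    moreover have "continuous_on (ball x0 1) (\<lambda>x. blinfun_apply (G x) v / I)"
      using I by (intro continuous_intros G(1)) auto
    ultimately have "continuous_on (ball x0 1) (\<lambda>x. D x v)"
      by (subst continuous_on_cong[OF refl]) auto
    then show "isCont (\<lambda>x. D x v) x0" by (simp add: continuous_on_eq_continuous_at)
  qed
  have "zperiodic \<psi>"
    unfolding zperiodic_def
  proof (intro allI impI)
    fix x k :: "real^'n" assume "\<forall>i. k $ i \<in> \<int>"
    then have "\<phi> (x + k + z) = \<phi> (x + z)" for z
      using per[unfolded zperiodic_def, rule_format, of k "x + z"] by (simp add: ac_simps)
    then show "\<psi> (x + k) = \<psi> x" by (simp add: \<psi>_def \<psi>0)
  qed
  then have c1: "c1_periodic \<psi> D" using D Dc by (simp add: c1_periodic_def)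
  have "- c \<le> D x v"
    if \<tau>: "\<tau> > 0" and le: "\<And>y T. norm (y - x) \<le> e \<Longrightarrow> 0 \<le> T \<Longrightarrow> T \<le> \<tau> \<Longrightarrow> \<phi> y - c * T \<le> \<phi> (y + T *\<^sub>R v)"
    for x v c \<tau>
  proof -
    have int: "integrable lborel (\<lambda>z. bump e z * \<phi> (y + z))" for y
    proof -
      have "continuous_on UNIV (\<lambda>z. \<phi> (y + z))"
        by (rule continuous_on_compose2[OF cont]) (auto intro!: continuous_intros)
      from integrable_bump_mult[OF e this, of 0] show ?thesis by simp
    qed
    have intb: "integrable lborel (bump e :: real^'n \<Rightarrow> real)"
      using integrable_bump_mult[OF e, of "\<lambda>_. 1" 0] by simp
    have quot: "- c \<le> (\<psi> (x + T *\<^sub>R v) - \<psi> x) / T" if T: "0 < T" "T \<le> \<tau>" for T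
    proof -
      have "\<psi>0 x - c * T * I = (\<integral>z. bump e z * \<phi> (x + z) - c * T * bump e z \<partial>lborel)"
        using int intb by (simp add: \<psi>0 I_def)
      also have "\<dots> \<le> (\<integral>z. bump e z * \<phi> (x + T *\<^sub>R v + z) \<partial>lborel)"
      proof (rule integral_mono)
        fix z :: "real^'n"
        show "bump e z * \<phi> (x + z) - c * T * bump e z \<le> bump e z * \<phi> (x + T *\<^sub>R v + z)"
        proof (cases "norm z \<le> e")
          case True
          then have "\<phi> (x + z) - c * T \<le> \<phi> (x + z + T *\<^sub>R v)" using le[of "x + z" T] T by simp
          then have "bump e z * (\<phi> (x + z) - c * T) \<le> bump e z * \<phi> (x + z + T *\<^sub>R v)"
            by (intro mult_left_mono bump_nonneg)
          then show ?thesis by (simp add: algebra_simps)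
        qed (use bump_eq_0[OF e, of z] in simp)
      qed (use int intb in auto)
      also have "\<dots> = \<psi>0 (x + T *\<^sub>R v)" by (simp add: \<psi>0)
      finally show ?thesis using I T by (simp add: \<psi>_def field_simps)
    qed
    \<comment> \<open>The direction is held constant at \<open>v\<close>, so the Hadamard quotient
      becomes a one-sided directional derivative.\<close>
    have "filterlim (\<lambda>T. (T, v)) (at_right (0::real) \<times>\<^sub>F nhds v) (at_right 0)"
      by (intro filterlim_Pair filterlim_ident tendsto_const)
    from filterlim_compose[OF hadamard_quotient_tendsto[OF D] this]
    have "((\<lambda>T. (\<psi> (x + T *\<^sub>R v) - \<psi> x) / T) \<longlongrightarrow> D x v) (at_right 0)" by simp
    then show ?thesis
      by (rule tendsto_lowerbound)
         (use \<tau> quot in \<open>auto simp: eventually_at_right_field intro!: exI[of _ \<tau>]\<close>)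
  qed
  with c1 show ?thesis by (rule that)
qed

subsection \<open>Superlinear Lagrangians\<close>

locale superlinear_lagrangian =
  fixes L :: "real^'n \<Rightarrow> real^'n \<Rightarrow> real"
  assumes per: "\<forall>v. zperiodic (\<lambda>x. L x v)"
    and cont: "continuous_on UNIV (\<lambda>z. L (fst z) (snd z))"
    and superlin: "filterlim (\<lambda>v. (INF x. L x v) / norm v) at_top at_infinity"
begin

lemma L_wrap: "L (wrap x) v = L x v"
  using zperiodic_wrap[of "\<lambda>x. L x v" x] per by simp

lemma L_continuous_left: "continuous_on UNIV (\<lambda>x. L x v)"
  using continuous_on_compose2[OF cont continuous_on_Pair[OF continuous_on_id continuous_on_const]]
  by simp

lemma L_bounded_on_ball:
  obtains B where "\<And>x v. norm v \<le> r \<Longrightarrow> \<bar>L x v\<bar> \<le> B"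
proof -
  let ?S = "cbox 0 1 \<times> cball (0::real^'n) r"
  have "compact ((\<lambda>z. L (fst z) (snd z)) ` ?S)"
    by (intro compact_continuous_image continuous_on_subset[OF cont] compact_Times) auto
  from compact_imp_bounded[OF this]
  obtain B where B: "\<forall>y\<in>(\<lambda>z. L (fst z) (snd z)) ` ?S. norm y \<le> B"
    unfolding bounded_iff by blast
  have "\<bar>L x v\<bar> \<le> B" if "norm v \<le> r" for x v
    using bspec[OF B imageI, of "(wrap x, v)"] wrap_in_cube[of x] that by (simp add: L_wrap)
  then show ?thesis by (rule that)
qed

lemma L_superlinear:
  obtains R where "R \<ge> 1" "\<And>x v. R \<le> norm v \<Longrightarrow> K * norm v \<le> L x v"
proof -
  have "\<forall>\<^sub>F v in at_infinity. K \<le> (INF x. L x v) / norm v"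
    using superlin by (simp add: filterlim_at_top)
  then obtain b where b: "\<And>v. b \<le> norm v \<Longrightarrow> K \<le> (INF x. L x v) / norm v"
    by (auto simp: eventually_at_infinity)
  have "K * norm v \<le> L x v" if v: "max 1 b \<le> norm v" for x v
  proof -
    \<comment> \<open>A real \<open>INF\<close> is a lower bound only for a set bounded below; the
      minimum over the torus provides this.\<close>
    obtain a where "\<And>x. L a v \<le> L x v"
      using zperiodic_attains_min[OF _ L_continuous_left] per by blast
    then have "bdd_below (range (\<lambda>x. L x v))" by (intro bdd_belowI[of _ "L a v"]) auto
    then have "(INF x. L x v) \<le> L x v" by (rule cINF_lower) auto
    moreover have "norm v > 0" using v by linarith
    then have "K * norm v \<le> (INF x. L x v)" using b[of v] v by (simp add: field_simps)
    ultimately show ?thesis by linarith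
  qed
  then show ?thesis by (intro that[of "max 1 b"]) auto
qed

lemma L_bounded_below:
  obtains m where "\<And>x v. m \<le> L x v"
proof -
  obtain R where R: "\<And>x v. R \<le> norm v \<Longrightarrow> 0 * norm v \<le> L x v" using L_superlinear by metis
  obtain B where B: "\<And>x v. norm v \<le> R \<Longrightarrow> \<bar>L x v\<bar> \<le> B" using L_bounded_on_ball by metis
  have "min 0 (- B) \<le> L x v" for x v
    using R[of v x] B[of v x] by (cases "norm v \<le> R") auto
  then show ?thesis by (rule that)
qed

text \<open>Makes the real-valued \<open>SUP\<close> in \<open>hamiltonian\<close> a genuine
  supremum. Outside a ball \<open>L\<close> exceeds \<open>norm p * norm v\<close>, and inside it
  \<open>L\<close> is bounded below.\<close>

lemma hamiltonian_bdd_above: "bdd_above (range (\<lambda>v. p \<bullet> v - L x v))"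
proof -
  obtain R where R: "R \<ge> 1" "\<And>x v. R \<le> norm v \<Longrightarrow> norm p * norm v \<le> L x v"
    using L_superlinear by metis
  obtain m where m: "\<And>x v. m \<le> L x v" using L_bounded_below by blast
  have "p \<bullet> v - L x v \<le> max 0 (norm p * R - m)" for v
  proof (cases "R \<le> norm v")
    case True
    then show ?thesis using R(2)[OF True, of x] norm_cauchy_schwarz[of p v] by linarith
  next
    case False
    then have "norm p * norm v \<le> norm p * R" by (intro mult_left_mono) auto
    then show ?thesis using norm_cauchy_schwarz[of p v] m[of x v] by linarith
  qed
  then show ?thesis by (intro bdd_aboveI) auto
qed

lemma hamiltonian_ge: "p \<bullet> v - L x v \<le> hamiltonian L x p"
  unfolding hamiltonian_def by (rule cSUP_upper[OF _ hamiltonian_bdd_above]) simp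

section \<open>Duality for holonomic measures\<close>

theorem dual_measure:
  obtains \<mu> where "holonomic \<mu>" "integrable \<mu> (\<lambda>z. L (fst z) (snd z))"
    "\<And>e. e > 0 \<Longrightarrow> \<exists>\<psi> D. c1_periodic \<psi> D \<and>
        (\<forall>x v. (\<integral>z. L (fst z) (snd z) \<partial>\<mu>) - e \<le> L x v + D x v)"
proof -
  obtain m where m: "\<And>x v. m \<le> L x v" using L_bounded_below by blast
  obtain C where "\<And>x v. norm v \<le> 1 \<Longrightarrow> \<bar>L x v\<bar> \<le> C" using L_bounded_on_ball by metis
  then have C: "\<And>x v. norm v \<le> 1 \<Longrightarrow> L x v \<le> C" by (simp add: abs_le_iff)
  \<comment> \<open>\<open>- K\<close> will bound \<open>D x v\<close> from below on unit
    velocities, by \<open>m \<le> ?A\<close>, \<open>L x v \<le> C\<close> and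
    \<open>e' \<le> 1\<close>. It does not depend on the test function, so the speed bound
    \<open>R\<close> can be fixed in advance.\<close>
  define K where "K = C - m + 1"
  obtain R where R1: "R \<ge> 1" and R': "\<And>x v. R \<le> norm v \<Longrightarrow> (K + \<bar>C\<bar>) * norm v \<le> L x v"
    using L_superlinear by metis
  have R: "K * norm v + C \<le> L x v" if "R \<le> norm v" for x v
  proof -
    have "1 * \<bar>C\<bar> \<le> norm v * \<bar>C\<bar>" using that R1 by (intro mult_right_mono) auto
    then have "K * norm v + C \<le> (K + \<bar>C\<bar>) * norm v" by (simp add: algebra_simps)
    then show ?thesis using R'[OF that, of x] by linarith
  qed
  define a b :: "(real^'n) \<times> (real^'n)" where "a = (0, \<chi> i. - R)" and "b = (1, \<chi> i. R)"
  have box: "(x, v) \<in> cbox a b" if "x \<in> cbox 0 1" "norm v \<le> R" for x v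
  proof -
    have "\<bar>v $ i\<bar> \<le> R" for i using component_le_norm_cart[of v i] that(2) by linarith
    then have "v \<in> cbox (\<chi> i. - R) (\<chi> i. R)" by (simp add: mem_box_cart abs_le_iff minus_le_iff)
    then show ?thesis using that(1) by (simp add: a_def b_def cbox_Pair_eq)
  qed
  have "(wrap 0, 0) \<in> cbox a b" using R1 wrap_in_cube by (intro box) auto
  \<comment> \<open>Measures on the box are traded for measures on [0,1]: \<open>L\<close> and the
    constraints are pulled back along a curve covering the box.\<close>
  obtain g :: "real \<Rightarrow> (real^'n) \<times> (real^'n)" where gc: "continuous_on UNIV g" and gonto: "cbox a b \<subseteq> g ` {0..1}"
    by (rule space_filling_curve)
  let ?V = "{\<lambda>t. D (fst (g t)) (snd (g t)) |\<psi> D. c1_periodic \<psi> D}"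
  let ?l = "\<lambda>t. L (fst (g t)) (snd (g t))"
  \<comment> \<open>At zero velocity every \<open>D\<close> vanishes by linearity: this is the
    common zero required by \<open>unit_duality\<close>.\<close>
  obtain t0 where t0: "t0 \<in> {0..1}" "g t0 = (wrap 0, 0)"
    using gonto \<open>(wrap 0, 0) \<in> cbox a b\<close> by (metis imageE subsetD)
  have comp: "continuous_on UNIV (\<lambda>t. h (fst (g t)) (snd (g t)))"
    if "continuous_on UNIV (\<lambda>z. h (fst z) (snd z))" for h :: "real^'n \<Rightarrow> real^'n \<Rightarrow> real"
    using continuous_on_compose2[OF that gc] by simp
  have lc: "continuous_on UNIV ?l" by (rule comp[OF cont])
  obtain M where M: "unit_dist M" "\<And>f. f \<in> ?V \<Longrightarrow> (\<integral>t. f t \<partial>M) = 0"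
    "\<And>e. e > 0 \<Longrightarrow> \<exists>f\<in>?V. \<forall>t\<in>{0..1}. (\<integral>t. ?l t \<partial>M) - e \<le> ?l t + f t"
  proof (rule unit_duality[OF lc, of ?V t0])
    show "continuous_on UNIV f" if "f \<in> ?V" for f
      using that comp c1_periodic_continuous by blast
    show "(\<lambda>_. 0) \<in> ?V"
      using c1_periodic_zero by (intro CollectI exI[of _ "\<lambda>_. 0"] exI[of _ "\<lambda>_ _. 0"]) auto
    show "(\<lambda>t. f t + h t) \<in> ?V" if fh: "f \<in> ?V" "h \<in> ?V" for f h
    proof -
      obtain \<psi> D \<psi>' D' where "c1_periodic \<psi> D" "c1_periodic \<psi>' D'"
        "f = (\<lambda>t. D (fst (g t)) (snd (g t)))" "h = (\<lambda>t. D' (fst (g t)) (snd (g t)))" using fh by blast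
      then show ?thesis using c1_periodic_add[of \<psi> D \<psi>' D']
        by (intro CollectI exI[of _ "\<lambda>x. \<psi> x + \<psi>' x"] exI[of _ "\<lambda>x v. D x v + D' x v"]) auto
    qed
    show "(\<lambda>t. c * f t) \<in> ?V" if f: "f \<in> ?V" for f c
    proof -
      obtain \<psi> D where "c1_periodic \<psi> D" "f = (\<lambda>t. D (fst (g t)) (snd (g t)))" using f by blast
      then show ?thesis using c1_periodic_mult[of \<psi> D c]
        by (intro CollectI exI[of _ "\<lambda>x. c * \<psi> x"] exI[of _ "\<lambda>x v. c * D x v"]) auto
    qed
    show "f t0 = 0" if f: "f \<in> ?V" for f
    proof -
      obtain \<psi> D where "c1_periodic \<psi> D" "f = (\<lambda>t. D (fst (g t)) (snd (g t)))" using f by blast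
      then show ?thesis using t0(2) linear_0[OF bounded_linear.linear[OF c1_periodic_linear]] by simp
    qed
  qed (use t0 in auto)
  interpret M: real_distribution M using M(1) by (simp add: unit_dist_def)
  \<comment> \<open>Wrapping the position puts the measure on the fundamental domain and leaves
    integrals of periodic functions unchanged.\<close>
  define W where "W t = (wrap (fst (g t)), snd (g t))" for t
  have fs: "(\<lambda>t. fst (g t)) \<in> borel_measurable borel" "(\<lambda>t. snd (g t)) \<in> borel_measurable borel"
    by (auto intro!: borel_measurable_continuous_onI continuous_intros gc)
  have W: "W \<in> borel_measurable borel"
    unfolding W_def using fs by (auto intro!: borel_measurable_Pair measurable_compose[OF _ wrap_measurable])
  define \<mu> where "\<mu> = distr M borel W"
  have WM: "W \<in> borel_measurable M" using W by simp
  have int: "integrable \<mu> (\<lambda>z. h (fst z) (snd z)) \<and>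
      (\<integral>z. h (fst z) (snd z) \<partial>\<mu>) = (\<integral>t. h (fst (g t)) (snd (g t)) \<partial>M)"
    if h: "continuous_on UNIV (\<lambda>z. h (fst z) (snd z))" and hp: "\<And>v. zperiodic (\<lambda>x. h x v)"
    for h :: "real^'n \<Rightarrow> real^'n \<Rightarrow> real"
  proof -
    have hm: "(\<lambda>z. h (fst z) (snd z)) \<in> borel_measurable borel"
      by (rule borel_measurable_continuous_onI[OF h])
    have hW: "h (fst (W t)) (snd (W t)) = h (fst (g t)) (snd (g t))" for t
      using zperiodic_wrap[OF hp] by (simp add: W_def)
    have "integrable M (\<lambda>t. h (fst (g t)) (snd (g t)))"
      by (rule unit_dist_integral_clamp(1)[OF M(1) comp[OF h]])
    then show ?thesis
      unfolding \<mu>_def integrable_distr_eq[OF WM hm] integral_distr[OF WM hm] hW by simp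
  qed
  let ?A = "\<integral>t. ?l t \<partial>M"
  have A: "integrable \<mu> (\<lambda>z. L (fst z) (snd z))" "(\<integral>z. L (fst z) (snd z) \<partial>\<mu>) = ?A"
    using int[OF cont] per by auto
  have hol: "holonomic \<mu>"
    unfolding holonomic_def torus_prob_def
  proof (intro conjI allI impI)
    show "sets \<mu> = sets borel" by (simp add: \<mu>_def)
    show "prob_space \<mu>" unfolding \<mu>_def by (rule M.prob_space_distr[OF WM])
    have "fund_dom = (\<Inter>i. {x::real^'n. 0 \<le> x $ i} \<inter> {x. x $ i < 1})" by (auto simp: fund_dom_def)
    moreover have "(\<Inter>i. {x::real^'n. 0 \<le> x $ i} \<inter> {x. x $ i < 1}) \<in> sets borel"
      by (intro sets.countable_INT' sets.Int) auto
    ultimately have "fund_dom \<in> sets (borel :: (real^'n) measure)" by simp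
    with borel_measurable_continuous_onI[OF continuous_on_fst[OF continuous_on_id]]
    have "fst -` fund_dom \<inter> space borel \<in> sets (borel :: ((real^'n) \<times> (real^'n)) measure)"
      by (rule measurable_sets)
    then have "{z::(real^'n) \<times> (real^'n). fst z \<in> fund_dom} \<in> sets borel" by (simp add: vimage_def)
    then show "AE z in \<mu>. fst z \<in> fund_dom"
      unfolding \<mu>_def by (subst AE_distr_iff[OF WM]) (auto simp: W_def wrap_in_fund_dom)
    show "integrable \<mu> (\<lambda>z. norm (snd z))"
      using int[of "\<lambda>x v. norm v", OF continuous_on_norm[OF continuous_on_snd[OF continuous_on_id]]]
      by (simp add: zperiodic_def)
    fix \<phi> :: "real^'n \<Rightarrow> real" and D
    assume "zperiodic \<phi> \<and> (\<forall>x. (\<phi> has_derivative D x) (at x)) \<and> (\<forall>v. continuous_on UNIV (\<lambda>x. D x v))"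
    then have c1: "c1_periodic \<phi> D" by (simp add: c1_periodic_def)
    have "(\<integral>z. D (fst z) (snd z) \<partial>\<mu>) = (\<integral>t. D (fst (g t)) (snd (g t)) \<partial>M)"
      using int[OF c1_periodic_continuous[OF c1] c1_periodic_D_periodic[OF c1]] by simp
    also have "\<dots> = 0" using c1 by (intro M(2)) blast
    finally show "(\<integral>z. D (fst z) (snd z) \<partial>\<mu>) = 0" .
  qed
  show ?thesis
  proof (rule that[OF hol A(1)])
    fix e :: real assume "e > 0"
    \<comment> \<open>The cap at 1 keeps the constant \<open>K\<close> valid for every
      \<open>e\<close>.\<close>
    define e' where "e' = min e 1"
    have e': "e' > 0" "e' \<le> e" "e' \<le> 1" using \<open>e > 0\<close> by (auto simp: e'_def)
    obtain \<psi> D where c1: "c1_periodic \<psi> D"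
      and "\<forall>t\<in>{0..1}. ?A - e' \<le> ?l t + D (fst (g t)) (snd (g t))"
      using M(3)[OF e'(1)] by blast
    note ineq = bspec[OF this(2)]
    have small: "?A - e' \<le> L x v + D x v" if v: "norm v \<le> R" for x v
    proof -
      have "(wrap x, v) \<in> g ` {0..1}" by (rule subsetD[OF gonto box[OF wrap_in_cube v]])
      then obtain t where t: "(wrap x, v) = g t" "t \<in> {0..1}" by (rule imageE)
      have "D (wrap x) v = D x v" by (rule zperiodic_wrap[OF c1_periodic_D_periodic[OF c1]])
      then show ?thesis using ineq[OF t(2)] L_wrap[of x v] by (simp add: t(1)[symmetric])
    qed
    have mA: "m \<le> ?A" by (rule unit_dist_integral_ge[OF M(1) lc m])
    interpret D: bounded_linear "D x" for x by (rule c1_periodic_linear[OF c1])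
    have AC: "?A - e' \<le> C" using small[of 0 0] C[of 0 0] R1 by (simp add: D.zero)
    have Dunit: "- K \<le> D x v" if "norm v \<le> 1" for x v
      using small[of v x] C[OF that, of x] that R1 mA e'(3) by (simp add: K_def)
    have "?A - e \<le> L x v + D x v" for x v
    proof (cases "norm v \<le> R")
      case True
      then show ?thesis using small[of v x] e'(2) by simp
    next
      case False
      then have nv: "norm v > 0" using R1 by linarith
      \<comment> \<open>Linearity scales the bound on unit velocities to
        \<open>- K * norm v\<close>; for fast \<open>v\<close>, \<open>L\<close> compensates this
        and leaves \<open>C\<close>, which is at least \<open>?A - e'\<close>.\<close>
      have "- K \<le> D x ((1 / norm v) *\<^sub>R v)" using nv by (intro Dunit) simp
      then have "- K * norm v \<le> D x v" using nv by (simp add: D.scaleR field_simps)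
      moreover have "K * norm v + C \<le> L x v" using False by (intro R) simp
      ultimately show ?thesis using AC e'(2) by simp
    qed
    then show "\<exists>\<psi> D. c1_periodic \<psi> D \<and> (\<forall>x v. (\<integral>z. L (fst z) (snd z) \<partial>\<mu>) - e \<le> L x v + D x v)"
      using c1 A(2) by auto
  qed
qed

text \<open>Integrating the inequality removes the \<open>D\<close> term by holonomy; if
  \<open>L\<close> is not integrable, the action is infinite.\<close>

lemma weak_duality:
  assumes \<nu>: "holonomic \<nu>" and c1: "c1_periodic \<psi> D" and le: "\<And>x v. c \<le> L x v + D x v"
  shows "ereal c \<le> action L \<nu>"
proof (cases "integrable \<nu> (\<lambda>z. L (fst z) (snd z))")
  case True
  interpret prob_space \<nu> using \<nu> by (simp add: holonomic_def torus_prob_def)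
  have sets: "sets \<nu> = sets borel" using \<nu> by (simp add: holonomic_def torus_prob_def)
  obtain B where B: "\<And>x v. \<bar>D x v\<bar> \<le> B * norm v" using c1_periodic_bounded[OF c1] by blast
  have iD: "integrable \<nu> (\<lambda>z. D (fst z) (snd z))"
  proof (rule Bochner_Integration.integrable_bound)
    show "integrable \<nu> (\<lambda>z. B * norm (snd z))" using \<nu> by (simp add: holonomic_def)
    show "(\<lambda>z. D (fst z) (snd z)) \<in> borel_measurable \<nu>"
      using borel_measurable_continuous_onI[OF c1_periodic_continuous[OF c1]]
        measurable_cong_sets[OF sets refl] by blast
    show "AE z in \<nu>. norm (D (fst z) (snd z)) \<le> norm (B * norm (snd z))"
    proof (rule AE_I2)
      fix z
      show "norm (D (fst z) (snd z)) \<le> norm (B * norm (snd z))"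
        using B[of "fst z" "snd z"] by (metis abs_ge_self order_trans real_norm_def)
    qed
  qed
  have "(\<integral>z. D (fst z) (snd z) \<partial>\<nu>) = 0" using \<nu> c1 by (auto simp: holonomic_def c1_periodic_def)
  then have "(\<integral>z. L (fst z) (snd z) \<partial>\<nu>) = (\<integral>z. L (fst z) (snd z) + D (fst z) (snd z) \<partial>\<nu>)"
    using True iD by simp
  moreover have "c \<le> (\<integral>z. L (fst z) (snd z) + D (fst z) (snd z) \<partial>\<nu>)"
    using True iD le by (intro integral_ge_const) auto
  ultimately show ?thesis using True by (simp add: action_def)
qed (simp add: action_def)

section \<open>Bounds from the viscosity inequalities\<close>

lemma supersolution_bound:
  assumes vis: "viscosity_solution L \<phi> H" and c1: "c1_periodic \<psi> D" and le: "\<And>x v. c \<le> L x v + D x v"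
  shows "c \<le> - H"
proof -
  have \<psi>c: "continuous_on UNIV \<psi>"
    using c1 by (auto simp: c1_periodic_def continuous_on_eq_continuous_at intro: has_derivative_continuous)
  have "zperiodic (\<lambda>x. \<phi> x - \<psi> x)" "continuous_on UNIV (\<lambda>x. \<phi> x - \<psi> x)"
    using vis c1 \<psi>c by (auto simp: viscosity_solution_def c1_periodic_def zperiodic_def intro!: continuous_intros)
  then obtain x0 where x0: "\<And>x. \<phi> x0 - \<psi> x0 \<le> \<phi> x - \<psi> x" using zperiodic_attains_min by blast
  define p where "p = (\<chi> i. D x0 (axis i 1))"
  have Dp: "D x0 v = p \<bullet> v" for v unfolding p_def by (rule c1_periodic_gradient[OF c1])
  then have "D x0 = (\<bullet>) p" by auto
  then have "(\<psi> has_derivative (\<bullet>) p) (at x0)" using c1 by (metis c1_periodic_def)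
  then have "p \<in> hsubdiff \<phi> x0" using x0 by (rule hsubdiff_of_minimum)
  then have "H \<le> hamiltonian L x0 (- p)" using vis by (simp add: viscosity_solution_def)
  \<comment> \<open>At \<open>x0\<close> the hypothesis says
    \<open>- p \<bullet> v - L x0 v \<le> - c\<close> for every \<open>v\<close>, which bounds the
    supremum.\<close>
  also have "\<dots> \<le> - c"
    unfolding hamiltonian_def using le[of x0] Dp by (intro cSUP_least) (auto simp: algebra_simps)
  finally show ?thesis by simp
qed

text \<open>Maximise \<open>\<phi>(x + s v + z) - k \<bar>z\<bar>\<^sup>2 + c s\<close>. Stationarity in \<open>y = x + s v + z\<close> at fixed \<open>s\<close> puts
  \<open>2 k z\<close> into the superdifferential at \<open>y\<close>; stationarity in \<open>s\<close> at fixed \<open>y\<close>, if \<open>s < T\<close>, then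
  contradicts the equation. So the maximum sits at \<open>s = T\<close>.\<close>
lemma subsolution_along_segment:
  assumes vis: "viscosity_solution L \<phi> H" and T: "0 \<le> T" and r: "0 < r"
    and c: "\<And>s z. 0 \<le> s \<Longrightarrow> s \<le> T \<Longrightarrow> norm z \<le> r \<Longrightarrow> L (x + s *\<^sub>R v + z) v + H < c"
  shows "\<phi> x - c * T \<le> \<phi> (x + T *\<^sub>R v)"
proof (rule field_le_epsilon)
  fix \<delta> :: real assume \<delta>: "\<delta> > 0"
  have \<phi>c: "continuous_on UNIV \<phi>" and \<phi>p: "zperiodic \<phi>" using vis by (auto simp: viscosity_solution_def)
  obtain B where B: "\<And>x. \<bar>\<phi> x\<bar> \<le> B" using zperiodic_bounded[OF \<phi>p \<phi>c] by blast
  obtain d where d: "d > 0" "\<And>y. dist y (x + T *\<^sub>R v) < d \<Longrightarrow> dist (\<phi> y) (\<phi> (x + T *\<^sub>R v)) < \<delta>"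
    using \<phi>c \<delta> unfolding continuous_on_iff by (metis UNIV_I)
  \<comment> \<open>\<open>\<rho> \<le> r\<close> keeps the maximum where hypothesis
    \<open>c\<close> applies; \<open>\<rho> < d\<close> keeps its end point where
    \<open>\<phi>\<close> varies by less than \<open>\<delta>\<close>.\<close>
  define \<rho> where "\<rho> = min r (d / 2)"
  have \<rho>: "\<rho> > 0" "\<rho> \<le> r" "\<rho> < d" using r d(1) by (auto simp: \<rho>_def)
  \<comment> \<open>On the sphere of radius \<open>\<rho>\<close> the penalty is
    \<open>2 * B + 1\<close>, more than the oscillation of \<open>\<phi>\<close>. So no
    \<open>z\<close> outside the ball beats 0, and the maximum is global in \<open>z\<close>, as
    \<open>hsupdiff_of_maximum\<close> demands.\<close>
  define k where "k = (2 * B + 1) / \<rho>\<^sup>2"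
  have B0: "0 \<le> B" using B[of 0] by linarith
  have k: "k > 0" "k * \<rho>\<^sup>2 = 2 * B + 1" using \<rho> B0 by (auto simp: k_def)
  define F where "F = (\<lambda>(s, z). \<phi> (x + s *\<^sub>R v + z) - k * (z \<bullet> z) + c * s)"
  let ?S = "{0..T} \<times> cball (0::real^'n) \<rho>"
  have "continuous_on ?S F"
    unfolding F_def case_prod_unfold by (intro continuous_intros continuous_on_compose2[OF \<phi>c]) auto
  moreover have "compact ?S" by (intro compact_Times) auto
  moreover have "?S \<noteq> {}" using T \<rho> by auto
  ultimately obtain p0 where p0: "p0 \<in> ?S" "\<forall>p\<in>?S. F p \<le> F p0" using continuous_attains_sup by blast
  obtain s0 z0 where sz: "p0 = (s0, z0)" by (cases p0)
  have s0: "0 \<le> s0" "s0 \<le> T" and z0: "norm z0 \<le> \<rho>" using p0(1) sz by auto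
  have Fmax: "F (s, z) \<le> F (s0, z0)" if s: "0 \<le> s" "s \<le> T" for s z
  proof (cases "norm z \<le> \<rho>")
    case True
    then show ?thesis using p0(2) s sz by auto
  next
    case False
    then have "\<rho>\<^sup>2 \<le> z \<bullet> z" using \<rho> by (simp add: dot_square_norm power_mono)
    then have "k * \<rho>\<^sup>2 \<le> k * (z \<bullet> z)" using k by (intro mult_left_mono) auto
    then have "F (s, z) \<le> F (s, 0)"
      using B[of "x + s *\<^sub>R v + z"] B[of "x + s *\<^sub>R v"] k(2) by (simp add: F_def abs_le_iff)
    also have "\<dots> \<le> F (s0, z0)" using p0(2) s sz \<rho> by auto
    finally show ?thesis .
  qed
  define y0 where "y0 = x + s0 *\<^sub>R v + z0"
  define q where "q = (2 * k) *\<^sub>R z0"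
  have "q \<in> hsupdiff \<phi> y0"
  proof (rule hsupdiff_of_maximum)
    let ?\<psi> = "\<lambda>y. k * ((y - (x + s0 *\<^sub>R v)) \<bullet> (y - (x + s0 *\<^sub>R v)))"
    show "(?\<psi> has_derivative (\<bullet>) q) (at y0)"
      by (rule derivative_eq_intros | rule refl)+ (auto simp: q_def y0_def inner_commute fun_eq_iff)
    show "\<phi> y - ?\<psi> y \<le> \<phi> y0 - ?\<psi> y0" for y
      using Fmax[OF s0, of "y - (x + s0 *\<^sub>R v)"] by (simp add: F_def y0_def)
  qed
  then have "hamiltonian L y0 (- q) \<le> H" using vis by (simp add: viscosity_solution_def)
  then have "(- q) \<bullet> v - L y0 v \<le> H" using hamiltonian_ge order_trans by blast
  moreover have "L y0 v + H < c" unfolding y0_def using s0 z0 \<rho> by (intro c) auto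
  ultimately have qv: "- (q \<bullet> v) < c" by simp
  have "s0 = T"
  proof (rule ccontr)
    assume "s0 \<noteq> T"
    then have sT: "s0 < T" using s0 by simp
    have le: "c \<le> - (q \<bullet> v) + h * (k * (v \<bullet> v))" if h: "0 < h" "h \<le> T - s0" for h
    proof -
      \<comment> \<open>Time advances by \<open>h\<close> while \<open>z\<close> moves back by
        \<open>h *\<^sub>R v\<close>: the point stays at \<open>y0\<close>, and only the penalty and
        \<open>c * s\<close> change.\<close>
      have "F (s0 + h, z0 - h *\<^sub>R v) \<le> F (s0, z0)" using h s0 by (intro Fmax) auto
      then have "c * h \<le> k * ((z0 - h *\<^sub>R v) \<bullet> (z0 - h *\<^sub>R v)) - k * (z0 \<bullet> z0)"
        by (simp add: F_def algebra_simps)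
      also have "\<dots> = h * (- (q \<bullet> v) + h * (k * (v \<bullet> v)))"
        by (simp add: q_def inner_diff_left inner_diff_right inner_commute algebra_simps)
      finally show ?thesis using h by (simp add: mult.commute)
    qed
    have "((\<lambda>h. - (q \<bullet> v) + h * (k * (v \<bullet> v))) \<longlongrightarrow> - (q \<bullet> v) + 0 * (k * (v \<bullet> v))) (at_right 0)"
      by (intro tendsto_intros)
    then have "c \<le> - (q \<bullet> v) + 0 * (k * (v \<bullet> v))"
      by (rule tendsto_lowerbound)
         (use sT le in \<open>auto simp: eventually_at_right_field intro!: exI[of _ "T - s0"]\<close>)
    then show False using qv by simp
  qed
  then have "\<phi> x \<le> \<phi> (x + T *\<^sub>R v + z0) - k * (z0 \<bullet> z0) + c * T"
    using Fmax[of 0 0] T by (simp add: F_def)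
  moreover have "dist (x + T *\<^sub>R v + z0) (x + T *\<^sub>R v) < d" using z0 \<rho> by (simp add: dist_norm)
  then have "\<phi> (x + T *\<^sub>R v + z0) < \<phi> (x + T *\<^sub>R v) + \<delta>"
    using d(2) by (fastforce simp: dist_real_def abs_less_iff)
  moreover have "0 \<le> k * (z0 \<bullet> z0)" using k by simp
  ultimately show "\<phi> x - c * T \<le> \<phi> (x + T *\<^sub>R v) + \<delta>" by linarith
qed

text \<open>Compactness gives uniformity once an integer translation brings \<open>x\<close> into
  the unit cube; \<open>x'\<close> is then at most 1 away in each coordinate, whence the box from -1
  to 2.\<close>

lemma L_uniformly_continuous:
  assumes "e > 0"
  obtains d where "d > 0" "\<And>x x' v. norm v \<le> R \<Longrightarrow> norm (x' - x) < d \<Longrightarrow> \<bar>L x' v - L x v\<bar> < e"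
proof -
  let ?S = "cbox (\<chi> i. - 1) (\<chi> i. 2) \<times> cball (0::real^'n) R"
  have "uniformly_continuous_on ?S (\<lambda>z. L (fst z) (snd z))"
    by (intro compact_uniformly_continuous continuous_on_subset[OF cont] compact_Times) auto
  then obtain d where d: "d > 0" "\<And>z z'. z \<in> ?S \<Longrightarrow> z' \<in> ?S \<Longrightarrow> dist z' z < d \<Longrightarrow>
      dist (L (fst z') (snd z')) (L (fst z) (snd z)) < e"
    using \<open>e > 0\<close> unfolding uniformly_continuous_on_def by metis
  have "\<bar>L x' v - L x v\<bar> < e" if v: "norm v \<le> R" and xx': "norm (x' - x) < min d 1" for x x' v
  proof -
    have "x - wrap x = (\<chi> i. of_int \<lfloor>x $ i\<rfloor>)" by (simp add: wrap_def vec_eq_iff frac_def)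
    then have "\<forall>i. (x - wrap x) $ i \<in> \<int>" by simp
    then have L': "L (wrap x + (x' - x)) v = L x' v"
      using per[unfolded zperiodic_def, rule_format, of "x - wrap x" "wrap x + (x' - x)" v] by simp
    have w: "0 \<le> wrap x $ i \<and> wrap x $ i \<le> 1" for i using wrap_in_cube[of x] by (simp add: mem_box_cart)
    have "\<bar>(x' - x) $ i\<bar> \<le> 1" for i using component_le_norm_cart[of "x' - x" i] xx' by linarith
    then have d1: "-1 \<le> (x' - x) $ i \<and> (x' - x) $ i \<le> 1" for i by (simp only: abs_le_iff) (meson minus_le_iff)
    have "(wrap x, v) \<in> ?S"
      using v w by (auto simp: mem_box_cart intro: order_trans[of _ 0] order_trans[of _ 1])
    moreover have "(wrap x + (x' - x), v) \<in> ?S"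
    proof -
      have "- 1 \<le> (wrap x + (x' - x)) $ i \<and> (wrap x + (x' - x)) $ i \<le> 2" for i
        using w[of i] d1[of i] by simp
      then show ?thesis using v by (simp add: mem_box_cart)
    qed
    moreover have "dist (wrap x + (x' - x), v) (wrap x, v) < d" using xx' by (simp add: dist_norm)
    ultimately show ?thesis using d(2) by (force simp: L' L_wrap dist_real_def)
  qed
  then show ?thesis using that[of "min d 1"] d(1) by simp
qed

text \<open>\<open>\<psi>\<close> is a mollification of \<open>\<phi>\<close>. For speeds up to
  \<open>R\<close>, uniform continuity of \<open>L\<close> gives the increments along short
  segments; for larger speeds a one-sided Lipschitz bound on \<open>\<phi>\<close> is absorbed by
  superlinearity.\<close>

lemma subsolution_bound:
  assumes vis: "viscosity_solution L \<phi> H" and e: "e > 0"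
  obtains \<psi> D where "c1_periodic \<psi> D" "\<And>x v. - H - e \<le> L x v + D x v"
proof -
  have \<phi>c: "continuous_on UNIV \<phi>" and \<phi>p: "zperiodic \<phi>" using vis by (auto simp: viscosity_solution_def)
  obtain C where C: "\<And>x v. norm v \<le> 1 \<Longrightarrow> \<bar>L x v\<bar> \<le> C" using L_bounded_on_ball by metis
  \<comment> \<open>\<open>K\<close> exceeds \<open>L + H\<close> for velocities of norm at most 1,
    so it serves as \<open>c\<close> on unit-speed segments; rescaling gives the Lipschitz
    bound.\<close>
  define K where "K = \<bar>C\<bar> + \<bar>H\<bar> + 1"
  have lip: "\<phi> y - K * norm v * T \<le> \<phi> (y + T *\<^sub>R v)" if T: "0 \<le> T" for y v T
  proof (cases "v = 0")
    case False
    define w where "w = (1 / norm v) *\<^sub>R v"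
    have w: "norm w \<le> 1" using False by (simp add: w_def)
    have "\<phi> y - K * (T * norm v) \<le> \<phi> (y + (T * norm v) *\<^sub>R w)"
    proof (rule subsolution_along_segment[OF vis, of _ 1])
      fix s z
      show "L (y + s *\<^sub>R w + z) w + H < K" using C[OF w, of "y + s *\<^sub>R w + z"] unfolding K_def by linarith
    qed (use T in auto)
    then show ?thesis using False by (simp add: w_def mult.assoc mult.commute[of T])
  qed simp
  obtain R where R1: "R \<ge> 1" and R': "\<And>x v. R \<le> norm v \<Longrightarrow> (K + \<bar>H\<bar>) * norm v \<le> L x v"
    using L_superlinear by metis
  have R: "K * norm v + \<bar>H\<bar> \<le> L x v" if "R \<le> norm v" for x v
  proof -
    have "1 * \<bar>H\<bar> \<le> norm v * \<bar>H\<bar>" using that R1 by (intro mult_right_mono) auto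
    then have "K * norm v + \<bar>H\<bar> \<le> (K + \<bar>H\<bar>) * norm v" by (simp add: algebra_simps)
    then show ?thesis using R'[OF that, of x] by linarith
  qed
  obtain d where d: "d > 0" "\<And>x x' v. norm v \<le> R \<Longrightarrow> norm (x' - x) < d \<Longrightarrow> \<bar>L x' v - L x v\<bar> < e"
    using L_uniformly_continuous[OF e] by metis
  \<comment> \<open>Three displacements of size at most \<open>\<epsilon>\<close> must add up to
    less than \<open>d\<close>: mollification, motion along \<open>v\<close>, and the penalised
    variable \<open>z\<close>.\<close>
  define \<epsilon> where "\<epsilon> = d / 4"
  have \<epsilon>: "\<epsilon> > 0" using d by (simp add: \<epsilon>_def)
  obtain \<psi> D where c1: "c1_periodic \<psi> D"
    and Dge: "\<And>x v c \<tau>. \<tau> > 0 \<Longrightarrow> (\<And>y T. norm (y - x) \<le> \<epsilon> \<Longrightarrow> 0 \<le> T \<Longrightarrow> T \<le> \<tau> \<Longrightarrow> \<phi> y - c * T \<le> \<phi> (y + T *\<^sub>R v))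
       \<Longrightarrow> - c \<le> D x v"
    using smooth_approximation[OF \<phi>p \<phi>c \<epsilon>] by blast
  have "- H - e \<le> L x v + D x v" for x v
  proof (cases "norm v \<le> R")
    case True
    \<comment> \<open>Within this time, motion of speed at most \<open>R\<close> covers at most
      \<open>\<epsilon>\<close>.\<close>
    define \<tau> where "\<tau> = \<epsilon> / R"
    have \<tau>: "\<tau> > 0" using \<epsilon> R1 by (simp add: \<tau>_def)
    have "- (L x v + H + e) \<le> D x v"
    proof (rule Dge[OF \<tau>])
      fix y T assume y: "norm (y - x) \<le> \<epsilon>" and T: "0 \<le> T" "T \<le> \<tau>"
      show "\<phi> y - (L x v + H + e) * T \<le> \<phi> (y + T *\<^sub>R v)"
      proof (rule subsolution_along_segment[OF vis T(1) \<epsilon>])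
        fix s :: real and z :: "real^'n" assume s: "0 \<le> s" "s \<le> T" and z: "norm z \<le> \<epsilon>"
        have "s * norm v \<le> \<tau> * R" using s T True R1 by (intro mult_mono) auto
        then have sv: "norm (s *\<^sub>R v) \<le> \<epsilon>" using s R1 by (simp add: \<tau>_def)
        have "norm ((y - x) + s *\<^sub>R v + z) \<le> \<epsilon> + \<epsilon> + \<epsilon>"
          by (intro norm_triangle_le add_mono y sv z)
        then have "norm (y + s *\<^sub>R v + z - x) < d" using d(1) by (simp add: \<epsilon>_def algebra_simps)
        from d(2)[OF True this] show "L (y + s *\<^sub>R v + z) v + H < L x v + H + e" by linarith
      qed
    qed
    then show ?thesis by simp
  next
    case False
    have "- (K * norm v) \<le> D x v" by (rule Dge[of 1]) (use lip in auto)
    moreover have "K * norm v + \<bar>H\<bar> \<le> L x v" using False by (intro R) simp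
    ultimately show ?thesis using e by linarith
  qed
  with c1 show ?thesis by (rule that)
qed

end

section \<open>Existence of a Mather measure and the value of its action\<close>

theorem theorem4:
  fixes L :: "real^'n \<Rightarrow> real^'n \<Rightarrow> real"
  assumes per: "\<forall>v. zperiodic (\<lambda>x. L x v)"
    and cont: "continuous_on UNIV (\<lambda>z. L (fst z) (snd z))"
    and superlin: "filterlim (\<lambda>v. (INF x. L x v) / norm v) at_top at_infinity"
  shows "(\<exists>\<mu>. mather_measure L \<mu>) \<and>
         (\<forall>\<mu> \<phi> Hbar. mather_measure L \<mu> \<longrightarrow> viscosity_solution L \<phi> Hbar \<longrightarrow>
            action L \<mu> = ereal (- Hbar))"
proof -
  interpret superlinear_lagrangian L using assms by unfold_locales
  obtain \<mu>0 where hol: "holonomic \<mu>0" and int: "integrable \<mu>0 (\<lambda>z. L (fst z) (snd z))"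
    and dual: "\<And>e. e > 0 \<Longrightarrow> \<exists>\<psi> D. c1_periodic \<psi> D \<and>
        (\<forall>x v. (\<integral>z. L (fst z) (snd z) \<partial>\<mu>0) - e \<le> L x v + D x v)"
    using dual_measure by blast
  define A where "A = (\<integral>z. L (fst z) (snd z) \<partial>\<mu>0)"
  have act0: "action L \<mu>0 = ereal A" using int by (simp add: action_def A_def)
  have lower: "ereal A \<le> action L \<nu>" if \<nu>: "holonomic \<nu>" for \<nu>
  proof (rule ereal_le_epsilon2)
    fix e :: real assume "0 < e"
    from dual[OF this] obtain \<psi> D where "c1_periodic \<psi> D" "\<And>x v. A - e \<le> L x v + D x v"
      unfolding A_def by blast
    from weak_duality[OF \<nu> this] have "ereal (A - e) + ereal e \<le> action L \<nu> + ereal e"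
      by (rule add_right_mono)
    then show "ereal A \<le> action L \<nu> + ereal e" by simp
  qed
  have inf: "(INF \<nu> \<in> {\<nu>. holonomic \<nu>}. action L \<nu>) = ereal A"
    using hol act0 lower by (intro antisym INF_greatest) (auto intro: INF_lower2)
  have "A = - Hbar" if vis: "viscosity_solution L \<phi> Hbar" for \<phi> Hbar
  proof (rule antisym)
    show "A \<le> - Hbar"
    proof (rule field_le_epsilon)
      fix e :: real assume "0 < e"
      from dual[OF this] obtain \<psi> D where "c1_periodic \<psi> D" "\<And>x v. A - e \<le> L x v + D x v"
        unfolding A_def by blast
      from supersolution_bound[OF vis this] show "A \<le> - Hbar + e" by simp
    qed
    show "- Hbar \<le> A"
    proof (rule field_le_epsilon)
      fix e :: real assume "0 < e"
      then obtain \<psi> D where "c1_periodic \<psi> D" "\<And>x v. - Hbar - e \<le> L x v + D x v"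
        using subsolution_bound[OF vis] by blast
      from weak_duality[OF hol this] show "- Hbar \<le> A + e" by (simp add: act0)
    qed
  qed
  moreover have "mather_measure L \<mu>0" using hol act0 inf by (simp add: mather_measure_def)
  \<comment> \<open>Every Mather measure has the infimum \<open>A\<close> as its action, so the
    identity found through \<open>\<mu>0\<close> holds for all of them.\<close>
  ultimately show ?thesis using inf by (auto simp: mather_measure_def)
qed

end
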